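(* There exists a positive numerical constant $\kappa$ (universal: not depending on $n$, $\mathcal X$, the design points, the distribution of the observations, $\mathcal F$, $\mathfrak c$ or $D$) such that the following holds. Assume that the random variables $Y_{1,n},\ldots,Y_{n,n}$ are independent, let $\mathfrak c\ge 0$, and let $\widehat f$ be an (estimator which is an) element of $\mathcal E_{\mathfrak c}(\boldsymbol Z,\mathcal F)$. Then, for every $D\in\{1,\ldots,n\}$ and every $\overline f\in\mathcal O(D)$, $$\mathbb E\left[\ell\left(\widehat f,\overline f\right)\right]\le 2\ell\left(f^\star,\overline f\right)+\kappa\inf_{p\in[1,2]}\left[\sigma_p(\mathbf x)\left(\frac Dn\right)^{1-\frac1p}\right]+\frac{\mathfrak c}{n}.$$ In particular, $$\mathbb E\left[\ell\left(f^\star,\widehat f\right)\right]\le\inf_{D\in\{1,\ldots,n\}}\left[3\ell\left(f^\star,\mathcal O(D)\right)+\kappa\inf_{p\in[1,2]}\left\{\sigma_p(\mathbf x)\left(\frac Dn\right)^{1-\frac1p}\right\}\right]+\frac{\mathfrak c}{n},$$ and when $Y_{1,n},\ldots,Y_{n,n}$ are square integrable, $$\mathbb E\left[\ell\left(f^\star,\widehat f\right)\right]\le\inf_{D\in\{1,\ldots,n\}}\left[3\ell\left(f^\star,\mathcal O(D)\right)+\kappa\sqrt{\left(\frac1n\sum_{i=1}^n\operatorname{Var}(Y_{i,n})\right)\frac Dn}\right]+\frac{\mathfrak c}{n}.$$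
   Context: Setting. $\mathcal X$ is a set, $n\ge1$, $x_{1,n},\ldots,x_{n,n}\in\mathcal X$ are deterministic points (possibly not all different), $\mathbf x=(x_{1,n},\ldots,x_{n,n})$, $Y_{1,n},\ldots,Y_{n,n}$ are integrable real-valued random variables, and $f^\star:\mathcal X\to\mathbb R$ is a function with $f^\star(x_{i,n})=\mathbb E[Y_{i,n}]$ for all $i$. $\boldsymbol Z=\{(x_{1,n},Y_{1,n}),\ldots,(x_{n,n},Y_{n,n})\}$ denotes the observations. $\mathcal F$ is a (nonempty) class of functions $\mathcal X\to\mathbb R$; $f^\star$ need not belong to $\mathcal F$. An estimator is a (measurable) function of the observations. Loss. For $f,g:\mathcal X\to\mathbb R$, $\ell(f,g)=\frac1n\sum_{i=1}^n|f(x_{i,n})-g(x_{i,n})|$, and for $\mathcal G\subset\mathcal F$, $\ell(f,\mathcal G)=\inf_{g\in\mathcal G}\ell(f,g)$, with $\inf_\varnothing=+\infty$. Moments. For $p\in[1,2]$, $\sigma_p(\mathbf x)=\left(\frac1n\sum_{i=1}^n\mathbb E[|Y_{i,n}-\mathbb E[Y_{i,n}]|^p]\right)^{1/p}\in[0,+\infty]$. Estimator. $\operatorname{sgn}(u)=1,0,-1$ according to $u>0$, $u=0$, $u<0$; $\operatorname{sgn}(f,g,x)=\operatorname{sgn}(f(x)-g(x))$. For $f,g\in\mathcal F$, $T(\boldsymbol Z,f,g)=\sum_{i=1}^n(f(x_{i,n})-Y_{i,n})\operatorname{sgn}(f,g,x_{i,n})$, $T(\boldsymbol Z,f)=\sup_{g\in\mathcal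 F}T(\boldsymbol Z,f,g)$, and for $\mathfrak c\ge0$, $\mathcal E_{\mathfrak c}(\boldsymbol Z,\mathcal F)=\{f\in\mathcal F:\ T(\boldsymbol Z,f)\le\inf_{g\in\mathcal F}T(\boldsymbol Z,g)+\mathfrak c\}$. VC-dimension. The VC-dimension of a class $\mathcal A$ of subsets of a set $\mathcal Y$ is not larger than $D$ if $|\{B\cap A: A\in\mathcal A\}|<2^{|B|}$ for every finite $B\subset\mathcal Y$ with $|B|>D$. Extremal elements. If $\mathcal G$ is a class of real-valued functions on a set $\mathcal Y$, $\overline g\in\mathcal G$ is extremal in $\mathcal G$ with degree not larger than $D\ge1$ if the classes of subsets of $\mathcal Y$, $\{\{g>\overline g\}: g\in\mathcal G\}$ and $\{\{g<\overline g\}: g\in\mathcal G\}$, both have VC-dimension not larger than $D$. Let $\mathcal X_n=\{x_{1,n},\ldots,x_{n,n}\}$, let $\pi_nf$ be the restriction of $f$ to $\mathcal X_n$, and $\mathcal F_n=\{\pi_nf: f\in\mathcal F\}$. For an integer $D\ge1$, $\mathcal O(D)$ is the set of those $\overline f\in\mathcal F$ such that $\pi_n\overline f$ is extremal in $\mathcal F_n$ with degree not larger than $D$. *)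

theory Defs
  imports "HOL-Probability.Probability"
begin

text \<open>The set of design indices is \<open>{1..n}\<close>. The type \<open>'a\<close> plays the role of the set of
  points, \<open>x i\<close> is the \<open>i\<close>-th design point, and a realisation of the observations is \<open>x\<close> together
  with the vector \<open>y\<close> of the responses \<open>y i\<close>, an element of the product space over \<open>{1..n}\<close>.\<close>

definition loss :: "(nat \<Rightarrow> 'a) \<Rightarrow> nat \<Rightarrow> ('a \<Rightarrow> real) \<Rightarrow> ('a \<Rightarrow> real) \<Rightarrow> real" where
  "loss x n f g = (1 / real n) * (\<Sum>i\<in>{1..n}. \<bar>f (x i) - g (x i)\<bar>)"

text \<open>Valued in \<^typ>\<open>ennreal\<close>, so that the infimum over the empty set is infinite.\<close>

definition loss_set :: "(nat \<Rightarrow> 'a) \<Rightarrow> nat \<Rightarrow> ('a \<Rightarrow> real) \<Rightarrow> ('a \<Rightarrow> real) set \<Rightarrow> ennreal" where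
  "loss_set x n f G = (INF g\<in>G. ennreal (loss x n f g))"

definition test_pair ::
  "(nat \<Rightarrow> 'a) \<Rightarrow> nat \<Rightarrow> (nat \<Rightarrow> real) \<Rightarrow> ('a \<Rightarrow> real) \<Rightarrow> ('a \<Rightarrow> real) \<Rightarrow> real" where
  "test_pair x n y f g = (\<Sum>i\<in>{1..n}. (f (x i) - y i) * sgn (f (x i) - g (x i)))"

text \<open>For a nonempty class \<open>F\<close> the real supremum and infimum below are genuine: the first family is
  bounded by the sum of the \<open>\<bar>f (x i) - y i\<bar>\<close>, and \<open>test_sup x n y F g \<ge> test_pair x n y g g = 0\<close>.\<close>

definition test_sup ::
  "(nat \<Rightarrow> 'a) \<Rightarrow> nat \<Rightarrow> (nat \<Rightarrow> real) \<Rightarrow> ('a \<Rightarrow> real) set \<Rightarrow> ('a \<Rightarrow> real) \<Rightarrow> real" where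
  "test_sup x n y F f = (SUP g\<in>F. test_pair x n y f g)"

definition estimator_set ::
  "(nat \<Rightarrow> 'a) \<Rightarrow> nat \<Rightarrow> (nat \<Rightarrow> real) \<Rightarrow> ('a \<Rightarrow> real) set \<Rightarrow> real \<Rightarrow> ('a \<Rightarrow> real) set" where
  "estimator_set x n y F c =
     {f \<in> F. test_sup x n y F f \<le> (INF g\<in>F. test_sup x n y F g) + c}"

definition vc_dim_le :: "'b set \<Rightarrow> 'b set set \<Rightarrow> nat \<Rightarrow> bool" where
  "vc_dim_le S \<A> D \<longleftrightarrow>
     (\<forall>B\<subseteq>S. finite B \<longrightarrow> card B > D \<longrightarrow> card ((\<lambda>A. B \<inter> A) ` \<A>) < 2 ^ card B)"

definition extremal :: "'b set \<Rightarrow> ('b \<Rightarrow> real) set \<Rightarrow> nat \<Rightarrow> ('b \<Rightarrow> real) \<Rightarrow> bool" where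
  "extremal S G D gbar \<longleftrightarrow> gbar \<in> G \<and>
     vc_dim_le S ((\<lambda>g. {s \<in> S. g s > gbar s}) ` G) D \<and>
     vc_dim_le S ((\<lambda>g. {s \<in> S. g s < gbar s}) ` G) D"

definition extremal_elements ::
  "(nat \<Rightarrow> 'a) \<Rightarrow> nat \<Rightarrow> ('a \<Rightarrow> real) set \<Rightarrow> nat \<Rightarrow> ('a \<Rightarrow> real) set" where
  "extremal_elements x n F D =
     {fbar \<in> F. extremal (x ` {1..n}) ((\<lambda>f. restrict f (x ` {1..n})) ` F) D
                  (restrict fbar (x ` {1..n}))}"

definition ennreal_root :: "real \<Rightarrow> ennreal \<Rightarrow> ennreal" where
  "ennreal_root p a = (if a = \<infinity> then \<infinity> else ennreal (enn2real a powr (1 / p)))"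

definition sigma_p :: "'w measure \<Rightarrow> nat \<Rightarrow> (nat \<Rightarrow> 'w \<Rightarrow> real) \<Rightarrow> real \<Rightarrow> ennreal" where
  "sigma_p M n Y p = ennreal_root p
     (ennreal (1 / real n) *
       (\<Sum>i\<in>{1..n}. \<integral>\<^sup>+\<omega>. ennreal (\<bar>Y i \<omega> - integral\<^sup>L M (Y i)\<bar> powr p) \<partial>M))"

definition noise_term :: "'w measure \<Rightarrow> nat \<Rightarrow> (nat \<Rightarrow> 'w \<Rightarrow> real) \<Rightarrow> nat \<Rightarrow> ennreal" where
  "noise_term M n Y D =
     (INF p\<in>{1..2}. sigma_p M n Y p * ennreal ((real D / real n) powr (1 - 1 / p)))"

definition responses :: "nat \<Rightarrow> (nat \<Rightarrow> 'w \<Rightarrow> real) \<Rightarrow> 'w \<Rightarrow> nat \<Rightarrow> real" where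
  "responses n Y \<omega> = (\<lambda>i\<in>{1..n}. Y i \<omega>)"

text \<open>An estimator is a function \<open>fhat\<close> of the (random part of the) observations whose values at the
  design points are measurable.\<close>

definition regression_setting ::
  "'w measure \<Rightarrow> nat \<Rightarrow> (nat \<Rightarrow> 'a) \<Rightarrow> (nat \<Rightarrow> 'w \<Rightarrow> real) \<Rightarrow> ('a \<Rightarrow> real) \<Rightarrow> ('a \<Rightarrow> real) set
     \<Rightarrow> real \<Rightarrow> ((nat \<Rightarrow> real) \<Rightarrow> 'a \<Rightarrow> real) \<Rightarrow> bool" where
  "regression_setting M n x Y fstar F c fhat \<longleftrightarrow>
     prob_space M \<and> n \<ge> 1 \<and>
     (\<forall>i\<in>{1..n}. integrable M (Y i)) \<and>
     (\<forall>i\<in>{1..n}. fstar (x i) = integral\<^sup>L M (Y i)) \<and>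
     prob_space.indep_vars M (\<lambda>_. borel) Y {1..n} \<and>
     F \<noteq> {} \<and> c \<ge> 0 \<and>
     (\<forall>i\<in>{1..n}. (\<lambda>y. fhat y (x i)) \<in> borel_measurable (Pi\<^sub>M {1..n} (\<lambda>_. borel))) \<and>
     (\<forall>\<omega>\<in>space M. fhat (responses n Y \<omega>) \<in> estimator_set x n (responses n Y \<omega>) F c)"

text \<open>The three risk bounds hold with the constant \<open>\<kappa>\<close> for all design points in \<open>'a\<close> and all
  probability spaces on \<open>'w\<close>. All bounds are inequalities in \<^typ>\<open>ennreal\<close>.\<close>

definition risk_bounds :: "'a itself \<Rightarrow> 'w itself \<Rightarrow> real \<Rightarrow> bool" where
  "risk_bounds _ _ \<kappa> \<longleftrightarrow>
    (\<forall>(M :: 'w measure) n (x :: nat \<Rightarrow> 'a) Y fstar F c fhat.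
      regression_setting M n x Y fstar F c fhat \<longrightarrow>
      (\<forall>D\<in>{1..n}. \<forall>fbar\<in>extremal_elements x n F D.
         (\<integral>\<^sup>+\<omega>. ennreal (loss x n (fhat (responses n Y \<omega>)) fbar) \<partial>M)
           \<le> 2 * ennreal (loss x n fstar fbar) + ennreal \<kappa> * noise_term M n Y D
               + ennreal (c / real n)) \<and>
      (\<integral>\<^sup>+\<omega>. ennreal (loss x n fstar (fhat (responses n Y \<omega>))) \<partial>M)
        \<le> (INF D\<in>{1..n}. 3 * loss_set x n fstar (extremal_elements x n F D)
                           + ennreal \<kappa> * noise_term M n Y D)
            + ennreal (c / real n) \<and>
      ((\<forall>i\<in>{1..n}. integrable M (\<lambda>\<omega>. (Y i \<omega>)\<^sup>2)) \<longrightarrow>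
        (\<integral>\<^sup>+\<omega>. ennreal (loss x n fstar (fhat (responses n Y \<omega>))) \<partial>M)
          \<le> (INF D\<in>{1..n}. 3 * loss_set x n fstar (extremal_elements x n F D)
                             + ennreal (\<kappa> * sqrt ((1 / real n * (\<Sum>i\<in>{1..n}. prob_space.variance M (Y i)))
                                                  * (real D / real n))))
              + ennreal (c / real n)))"

text \<open>HOL cannot quantify over types inside a formula, so \<open>\<exists>\<kappa>>0. risk_bounds TYPE('a) TYPE('w) \<kappa>\<close>
  alone would let the constant depend on the types \<open>'a\<close> and \<open>'w\<close>. A constant that is universal over
  all types is expressed by a pair of statements: some positive constant works for the fixed types
  \<^typ>\<open>nat\<close> (of points) and \<^typ>\<open>nat \<Rightarrow> real\<close> (of outcomes), where no type variable occurs, and every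
  positive constant that works there works for arbitrary \<open>'a\<close> and \<open>'w\<close>.\<close>

end

theory Submission
  imports Defs
begin

text \<open>Since \<open>|f - g| = (f - g) sgn(f, g)\<close>, one has \<open>n \<ell>(f, g) = T(Z, f, g) + T(Z, g, f)\<close>, hence
  \<open>n \<ell>(fhat, fbar) \<le> 2 T(Z, fbar) + c\<close>. Up to \<open>n \<ell>(fstar, fbar)\<close>, the quantity \<open>T(Z, fbar)\<close> is at most the
  sum of the suprema of \<open>\<Sum>\<^sub>i \<xi>\<^sub>i 1\<^sub>A(x\<^sub>i)\<close>, \<open>\<xi>\<close> the noise or its opposite, over the two VC classes attached to
  \<open>fbar\<close>. After symmetrization and conditionally on the noise, chaining bounds such a supremum by
  \<open>13 D/\<theta> + (5/2) \<theta> \<Sum>\<^sub>i \<xi>\<^sub>i\<^sup>2\<close> for every \<open>\<theta> > 0\<close>; no logarithm appears because the packing numbers of a VC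
  class grow only polynomially. Truncating the noise at level \<open>t = 1/\<theta>\<close> turns this into
  \<open>13 D t + (5/2) t\<^sup>1\<^sup>-\<^sup>p \<Sum>\<^sub>i |\<xi>\<^sub>i|\<^sup>p\<close>, and optimizing a deterministic \<open>t\<close> after taking expectations gives the
  rate \<open>\<sigma>\<^sub>p (D/n)\<^sup>1\<^sup>-\<^sup>1\<^sup>/\<^sup>p\<close>.\<close>

section \<open>Packing numbers of VC classes\<close>

text \<open>The noise may lack a second moment, so chaining cannot be run on it directly. Truncation
  comes after symmetrization, when the values of the noise are frozen and only the signs are random:
  the signs do the centring, and the truncated part needs no recentring. The parameter
  \<open>\<theta>\<close> is never optimized conditionally on the noise. The bound thus stays linear
  in the powers of the noise, and expectations pass through it term by term. The constant 124 is
  \<open>2 * 2 * (26 + 5)\<close>: symmetrization doubles 13 and \<open>5 / 2\<close> into 26 and 5,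
  there are two VC classes, and \<open>T(Z, fbar)\<close> enters the loss twice. The theorem also
  speaks of every constant that works at the fixed types, not only of 124, so a proof with 124 for
  all types does not settle it. A transfer is needed: the finitely many design points embed into
  \<open>nat\<close>, and a vector of responses is itself an outcome of type
  \<open>nat \<Rightarrow> real\<close>, so every setting has a copy at the fixed types with the
  same losses and moments.\<close>

definition shatters :: "'b set set \<Rightarrow> 'b set \<Rightarrow> bool" where
  "shatters \<A> S \<longleftrightarrow> (\<forall>C\<subseteq>S. \<exists>A\<in>\<A>. A \<inter> S = C)"

text \<open>Pajor's form of the Sauer-Shelah lemma, by removing a point \<open>b\<close>.
  \<open>\<A>n \<union> \<C>\<close> collects the traces of the members on \<open>B\<close>, and
  \<open>\<A>n \<inter> \<C>\<close> the traces that extend both with and without \<open>b\<close>.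
  If the latter family shatters \<open>S\<close>, then \<open>\<A>\<close> shatters
  \<open>insert b S\<close>; such sets contain \<open>b\<close>, so they differ from those shattered
  by the traces.\<close>

lemma card_le_card_shattered:
  fixes \<A> :: "'b set set"
  assumes "finite B" "\<A> \<subseteq> Pow B"
  shows "card \<A> \<le> card {S. S \<subseteq> B \<and> shatters \<A> S}"
  using assms
proof (induction B arbitrary: \<A> rule: finite_induct)
  case empty
  then have "\<A> = {} \<or> \<A> = {{}}" by auto
  then show ?case
  proof
    assume "\<A> = {{}}"
    moreover have "{S. S \<subseteq> {} \<and> shatters {{}} S} = {{} :: 'b set}" by (auto simp: shatters_def)
    ultimately show ?thesis by simp
  qed simp
next
  case (insert b B)
  define \<A>n \<A>b where "\<A>n = {A\<in>\<A>. b \<notin> A}" and "\<A>b = {A\<in>\<A>. b \<in> A}"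
  define \<C> where "\<C> = (\<lambda>A. A - {b}) ` \<A>b"
  have fin: "finite \<A>" using insert by (meson finite_Pow_iff finite_insert finite_subset)
  have inj: "inj_on (\<lambda>A. A - {b}) \<A>b" by (auto simp: inj_on_def \<A>b_def)
  have "card \<A> = card \<A>n + card \<A>b"
    using fin by (subst card_Un_disjoint[symmetric]) (auto simp: \<A>n_def \<A>b_def intro!: arg_cong[where f=card])
  also have "card \<A>b = card \<C>" using inj by (simp add: \<C>_def card_image)
  also have "card \<A>n + card \<C> = card (\<A>n \<union> \<C>) + card (\<A>n \<inter> \<C>)"
    using fin by (intro card_Un_Int) (auto simp: \<A>n_def \<A>b_def \<C>_def)
  finally have card: "card \<A> = card (\<A>n \<union> \<C>) + card (\<A>n \<inter> \<C>)" .
  have "\<A>n \<union> \<C> \<subseteq> Pow B" "\<A>n \<inter> \<C> \<subseteq> Pow B"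
    using insert.prems by (auto simp: \<A>n_def \<A>b_def \<C>_def)
  note IH = insert.IH[OF this(1)] insert.IH[OF this(2)]
  let ?S = "\<lambda>\<D>. {S. S \<subseteq> B \<and> shatters \<D> S}"
  have sub: "?S (\<A>n \<union> \<C>) \<union> insert b ` ?S (\<A>n \<inter> \<C>) \<subseteq> {S. S \<subseteq> insert b B \<and> shatters \<A> S}"
  proof (intro Un_least subsetI)
    fix S assume S: "S \<in> ?S (\<A>n \<union> \<C>)"
    then have "b \<notin> S" using insert.hyps by auto
    have "shatters \<A> S" unfolding shatters_def
    proof (intro allI impI)
      fix C assume "C \<subseteq> S"
      moreover have "shatters (\<A>n \<union> \<C>) S" using S by simp
      ultimately obtain A where "A \<in> \<A>n \<union> \<C>" "A \<inter> S = C" unfolding shatters_def by meson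
      then show "\<exists>A\<in>\<A>. A \<inter> S = C" using \<open>b \<notin> S\<close>
        by (auto simp: \<A>n_def \<A>b_def \<C>_def)
    qed
    then show "S \<in> {S. S \<subseteq> insert b B \<and> shatters \<A> S}" using S by auto
  next
    fix S' assume "S' \<in> insert b ` ?S (\<A>n \<inter> \<C>)"
    then obtain S where S: "S' = insert b S" "S \<subseteq> B" "shatters (\<A>n \<inter> \<C>) S" by auto
    then have "b \<notin> S" using insert.hyps by auto
    have "shatters \<A> S'" unfolding shatters_def
    proof (intro allI impI)
      fix C assume "C \<subseteq> S'"
      then have "C - {b} \<subseteq> S" using S by auto
      then obtain A where A: "A \<in> \<A>n \<inter> \<C>" "A \<inter> S = C - {b}" using S unfolding shatters_def by meson
      have mem: "A \<in> \<A>" "b \<notin> A" using A by (auto simp: \<A>n_def)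
      from A obtain A' where "A' \<in> \<A>" "b \<in> A'" "A = A' - {b}" by (auto simp: \<A>b_def \<C>_def)
      then have "insert b A \<in> \<A>" by (simp add: insert_absorb)
      show "\<exists>A\<in>\<A>. A \<inter> S' = C"
      proof (cases "b \<in> C")
        case True
        then show ?thesis using A(2) \<open>insert b A \<in> \<A>\<close> \<open>b \<notin> S\<close> S(1) by (intro bexI[of _ "insert b A"]) auto
      next
        case False
        then show ?thesis using A(2) mem S(1) by (intro bexI[of _ A]) auto
      qed
    qed
    then show "S' \<in> {S. S \<subseteq> insert b B \<and> shatters \<A> S}" using S by auto
  qed
  have "inj_on (insert b) (?S (\<A>n \<inter> \<C>))"
    using insert.hyps by (intro inj_onI) (metis (no_types, lifting) Diff_insert_absorb mem_Collect_eq subset_eq)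
  then have "card (?S (\<A>n \<union> \<C>)) + card (?S (\<A>n \<inter> \<C>))
      = card (?S (\<A>n \<union> \<C>)) + card (insert b ` ?S (\<A>n \<inter> \<C>))" by (simp add: card_image)
  also have "\<dots> = card (?S (\<A>n \<union> \<C>) \<union> insert b ` ?S (\<A>n \<inter> \<C>))"
    using insert.hyps by (intro card_Un_disjoint[symmetric]) auto
  also have "\<dots> \<le> card {S. S \<subseteq> insert b B \<and> shatters \<A> S}"
    using sub insert.hyps by (intro card_mono) auto
  finally show ?case using IH card by linarith
qed

lemma sum_power_card_Pow:
  fixes x :: real assumes "finite B"
  shows "(\<Sum>S\<in>Pow B. x ^ card S) = (1 + x) ^ card B"
  using assms
proof (induction B rule: finite_induct)
  case (insert b B)
  have "(\<Sum>S\<in>Pow (insert b B). x ^ card S) = (\<Sum>S\<in>Pow B. x ^ card S) + (\<Sum>S\<in>insert b ` Pow B. x ^ card S)"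
    unfolding Pow_insert using insert by (intro sum.union_disjoint) auto
  also have "(\<Sum>S\<in>insert b ` Pow B. x ^ card S) = (\<Sum>S\<in>Pow B. x ^ card (insert b S))"
    using insert by (subst sum.reindex) (auto simp: inj_on_def o_def)
  also have "\<dots> = (\<Sum>S\<in>Pow B. x * x ^ card S)"
    using insert by (intro sum.cong refl) (metis PowD card_insert_disjoint finite_subset power_Suc subsetD)
  finally show ?case using insert by (simp add: sum_distrib_left[symmetric] algebra_simps)
qed simp

text \<open>Weighting a shattered set by \<open>x ^ card S\<close>, which is at least
  \<open>x ^ D\<close>, replaces the usual sum of binomial coefficients by a generating function.
  The free \<open>x\<close> can be tuned to the size of \<open>B\<close> afterwards.\<close>

lemma card_bounded_shattering_le:
  fixes x :: real
  assumes "finite B" "\<A> \<subseteq> Pow B" "0 < x" "x \<le> 1"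
    and D: "\<And>S. S \<subseteq> B \<Longrightarrow> shatters \<A> S \<Longrightarrow> card S \<le> D"
  shows "card \<A> \<le> (1 / x) ^ D * (1 + x) ^ card B"
proof -
  let ?\<S> = "{S. S \<subseteq> B \<and> shatters \<A> S}"
  have "card ?\<S> * x ^ D = (\<Sum>S\<in>?\<S>. x ^ D)" by simp
  also have "\<dots> \<le> (\<Sum>S\<in>?\<S>. x ^ card S)"
    using assms by (intro sum_mono power_decreasing) auto
  also have "\<dots> \<le> (\<Sum>S\<in>Pow B. x ^ card S)"
    using assms by (intro sum_mono2) auto
  also have "\<dots> = (1 + x) ^ card B" using assms by (intro sum_power_card_Pow)
  finally have "card ?\<S> * x ^ D \<le> (1 + x) ^ card B" .
  then have "real (card ?\<S>) \<le> (1 / x) ^ D * (1 + x) ^ card B"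
    using \<open>0 < x\<close> by (simp add: field_simps)
  moreover have "card \<A> \<le> card ?\<S>" using assms by (intro card_le_card_shattered) auto
  ultimately show ?thesis by linarith
qed

text \<open>Greedy choice. If every point lay in less than a fraction \<open>\<delta>\<close> of the
  surviving sets, summing their weights in both orders would contradict the lower bound on
  \<open>sum w E\<close>. So some point hits that fraction, and each round leaves at most a fraction
  \<open>1 - \<delta>\<close> of the sets.\<close>

lemma hitting_set_exists:
  fixes w :: "'b \<Rightarrow> real" and \<delta> :: real
  assumes I: "finite I" "\<And>i. i \<in> I \<Longrightarrow> 0 \<le> w i" "0 < sum w I" and "finite P" "\<delta> \<le> 1"
    and P: "\<And>E. E \<in> P \<Longrightarrow> E \<subseteq> I \<and> \<delta> * sum w I \<le> sum w E"
  shows "\<exists>B\<subseteq>I. card B \<le> m \<and> card {E\<in>P. E \<inter> B = {}} \<le> (1 - \<delta>) ^ m * card P"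
proof (induction m)
  case 0
  show ?case by (intro exI[of _ "{}"]) auto
next
  case (Suc m)
  then obtain B where B: "B \<subseteq> I" "card B \<le> m" "card {E\<in>P. E \<inter> B = {}} \<le> (1 - \<delta>) ^ m * card P" by blast
  define Q where "Q = {E\<in>P. E \<inter> B = {}}"
  have [simp]: "finite Q" using assms by (simp add: Q_def)
  have "\<exists>i\<in>I. \<delta> * card Q \<le> card {E\<in>Q. i \<in> E}"
  proof (rule ccontr)
    assume "\<not> ?thesis"
    then have less: "card {E\<in>Q. i \<in> E} < \<delta> * card Q" if "i \<in> I" for i using that by (auto simp: not_le)
    have "\<delta> * sum w I * card Q = (\<Sum>E\<in>Q. \<delta> * sum w I)" by simp
    also have "\<dots> \<le> (\<Sum>E\<in>Q. sum w E)" using P by (intro sum_mono) (auto simp: Q_def)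
    also have "\<dots> = (\<Sum>E\<in>Q. \<Sum>i\<in>I. if i \<in> E then w i else 0)"
    proof (rule sum.cong[OF refl])
      fix E assume "E \<in> Q"
      then have "I \<inter> E = E" using P by (auto simp: Q_def)
      then show "sum w E = (\<Sum>i\<in>I. if i \<in> E then w i else 0)"
        using sum.inter_restrict[OF I(1), of w E] by simp
    qed
    also have "\<dots> = (\<Sum>i\<in>I. \<Sum>E\<in>Q. if i \<in> E then w i else 0)" by (rule sum.swap)
    also have "\<dots> = (\<Sum>i\<in>I. card {E\<in>Q. i \<in> E} * w i)"
      by (intro sum.cong refl) (simp add: sum.inter_filter[symmetric])
    also have "\<dots> < (\<Sum>i\<in>I. (\<delta> * card Q) * w i)"
    proof (rule sum_strict_mono_ex1)
      show "\<forall>i\<in>I. card {E\<in>Q. i \<in> E} * w i \<le> (\<delta> * card Q) * w i"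
        using I by (intro ballI mult_right_mono order.strict_implies_order[OF less]) auto
      obtain i where "i \<in> I" "0 < w i" using I by (meson not_le sum_nonpos)
      then show "\<exists>i\<in>I. card {E\<in>Q. i \<in> E} * w i < (\<delta> * card Q) * w i"
        using less \<open>i \<in> I\<close> \<open>0 < w i\<close> by (intro bexI[of _ i] mult_strict_right_mono) auto
    qed (use I in auto)
    also have "\<dots> = \<delta> * sum w I * card Q" by (simp add: sum_distrib_left[symmetric])
    finally show False by simp
  qed
  then obtain i where i: "i \<in> I" "\<delta> * card Q \<le> card {E\<in>Q. i \<in> E}" by blast
  have "card {E\<in>P. E \<inter> insert i B = {}} = card (Q - {E\<in>Q. i \<in> E})"
    by (intro arg_cong[where f=card]) (auto simp: Q_def)
  also have "\<dots> = card Q - card {E\<in>Q. i \<in> E}" by (intro card_Diff_subset) auto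
  also have "real \<dots> = card Q - real (card {E\<in>Q. i \<in> E})"
    by (intro of_nat_diff card_mono) auto
  also have "\<dots> \<le> (1 - \<delta>) * card Q" using i by (simp add: algebra_simps)
  also have "\<dots> \<le> (1 - \<delta>) * ((1 - \<delta>) ^ m * card P)"
    using B assms by (intro mult_left_mono) (auto simp: Q_def)
  finally have "card {E\<in>P. E \<inter> insert i B = {}} \<le> (1 - \<delta>) ^ Suc m * card P" by (simp add: mult.assoc)
  moreover have "card (insert i B) \<le> Suc m" using B(2) card_insert_le_m1[of "Suc m" B i] by simp
  ultimately show ?case using B i by (intro exI[of _ "insert i B"]) auto
qed

text \<open>A greedily chosen set \<open>B\<close> of about \<open>2 ln N / \<delta>\<close> points separates the \<open>N\<close> members of the packing, so that
  their traces on \<open>B\<close> are distinct and can be counted by Pajor's bound with \<open>x = \<delta>/4\<close>; the resulting factor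
  \<open>(1 + \<delta>/4)\<^sup>m\<close> is of order \<open>\<surd>N\<close> and is absorbed on the left.\<close>

lemma ln_card_packing_le:
  fixes w :: "'b \<Rightarrow> real" and \<delta> :: real
  assumes I: "finite I" "\<And>i. i \<in> I \<Longrightarrow> 0 \<le> w i" "0 < sum w I" and \<delta>: "0 < \<delta>" "\<delta> \<le> 1"
    and \<N>: "\<N> \<subseteq> Pow I" "\<N> \<noteq> {}"
    and sep: "\<And>A B. A \<in> \<N> \<Longrightarrow> B \<in> \<N> \<Longrightarrow> A \<noteq> B \<Longrightarrow> \<delta> * sum w I \<le> sum w (sym_diff A B)"
    and D: "\<And>S. S \<subseteq> I \<Longrightarrow> shatters \<N> S \<Longrightarrow> card S \<le> D"
  shows "ln (card \<N>) \<le> 2 * real D * ln (4 / \<delta>) + 1 / 2"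
proof -
  have fin: "finite \<N>" using \<N> I by (meson finite_Pow_iff finite_subset)
  define N where "N = real (card \<N>)"
  have "1 \<le> card \<N>" using fin \<N> by (simp add: Suc_leI card_gt_0_iff)
  then have N: "1 \<le> N" by (simp add: N_def)
  define P where "P = (\<lambda>(A, B). sym_diff A B) ` {p \<in> \<N> \<times> \<N>. fst p \<noteq> snd p}"
  have finP: "finite P" using fin by (simp add: P_def)
  have "card P \<le> card {p \<in> \<N> \<times> \<N>. fst p \<noteq> snd p}" unfolding P_def using fin by (intro card_image_le) auto
  also have "\<dots> \<le> card (\<N> \<times> \<N>)" using fin by (intro card_mono) auto
  also have "\<dots> = card \<N> * card \<N>" by (rule card_cartesian_product)
  finally have "real (card P) \<le> real (card \<N> * card \<N>)" by (rule of_nat_mono)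
  then have cardP: "card P \<le> N\<^sup>2" by (simp add: N_def power2_eq_square)
  \<comment> \<open>The least integer strictly above \<open>2 * ln N / \<delta>\<close>: strictness
    brings the number of missed differences, at most \<open>exp (2 * ln N - \<delta> * m)\<close>,
    below 1, hence to 0.\<close>
  define m where "m = nat \<lfloor>2 * ln N / \<delta>\<rfloor> + 1"
  have "0 \<le> 2 * ln N / \<delta>" using N \<delta> by simp
  then have "real m = \<lfloor>2 * ln N / \<delta>\<rfloor> + 1" unfolding m_def by simp
  then have m: "2 * ln N / \<delta> < m" "m \<le> 2 * ln N / \<delta> + 1" by linarith+
  have "\<exists>B\<subseteq>I. card B \<le> m \<and> card {E\<in>P. E \<inter> B = {}} \<le> (1 - \<delta>) ^ m * card P"
  proof (rule hitting_set_exists[OF I finP \<open>\<delta> \<le> 1\<close>])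
    fix E assume "E \<in> P"
    then obtain p where "p \<in> \<N> \<times> \<N>" "fst p \<noteq> snd p" "E = (\<lambda>(A, B). sym_diff A B) p"
      unfolding P_def by blast
    then obtain A B where "E = sym_diff A B" "A \<in> \<N>" "B \<in> \<N>" "A \<noteq> B" by (cases p) simp
    then show "E \<subseteq> I \<and> \<delta> * sum w I \<le> sum w E" using sep[of A B] \<N> by auto
  qed auto
  then obtain B where B: "B \<subseteq> I" "card B \<le> m" "card {E\<in>P. E \<inter> B = {}} \<le> (1 - \<delta>) ^ m * card P" by blast
  have "(1 - \<delta>) ^ m * card P \<le> exp (- \<delta>) ^ m * N\<^sup>2"
    using cardP \<delta> exp_ge_add_one_self[of "- \<delta>"] by (intro mult_mono power_mono) auto
  also have "\<dots> = exp (2 * ln N - \<delta> * m)"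
  proof -
    have "N\<^sup>2 = exp (2 * ln N)" using N by (simp add: exp_double)
    moreover have "exp (- \<delta>) ^ m = exp (- (\<delta> * m))" by (simp add: exp_of_nat_mult[symmetric])
    ultimately show ?thesis by (simp add: exp_add[symmetric])
  qed
  also have "\<dots> < 1" using m \<delta> by (simp add: field_simps)
  finally have "card {E\<in>P. E \<inter> B = {}} < 1" using B(3) by linarith
  then have hit: "E \<inter> B \<noteq> {}" if "E \<in> P" for E using that finP by auto
  define \<T> where "\<T> = (\<lambda>A. A \<inter> B) ` \<N>"
  have inj: "inj_on (\<lambda>A. A \<inter> B) \<N>"
  proof (rule inj_onI, rule ccontr)
    fix A A' assume *: "A \<in> \<N>" "A' \<in> \<N>" "A \<inter> B = A' \<inter> B" "A \<noteq> A'"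
    then have "sym_diff A A' \<in> P" by (auto simp: P_def intro!: image_eqI[of _ _ "(A, A')"])
    from hit[OF this] *(3) show False by blast
  qed
  have "card \<T> \<le> (1 / (\<delta> / 4)) ^ D * (1 + \<delta> / 4) ^ card B"
  proof (rule card_bounded_shattering_le)
    fix S assume S: "S \<subseteq> B" "shatters \<T> S"
    have "shatters \<N> S" unfolding shatters_def
    proof (intro allI impI)
      fix C assume "C \<subseteq> S"
      then obtain A where "A \<in> \<N>" "A \<inter> B \<inter> S = C" using S(2) unfolding shatters_def \<T>_def by blast
      then show "\<exists>A\<in>\<N>. A \<inter> S = C" using S(1) by blast
    qed
    then show "card S \<le> D" using S(1) B(1) by (intro D) auto
  qed (use \<delta> B I in \<open>auto simp: \<T>_def intro: finite_subset\<close>)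
  also have "(1 + \<delta> / 4) ^ card B \<le> (1 + \<delta> / 4) ^ m" using B \<delta> by (intro power_increasing) auto
  also have "(1 + \<delta> / 4) ^ m \<le> exp (\<delta> / 4) ^ m" using \<delta> by (intro power_mono) auto
  also have "exp (\<delta> / 4) ^ m = exp (\<delta> / 4 * m)" by (simp add: exp_of_nat_mult[symmetric])
  finally have "N \<le> (4 / \<delta>) ^ D * exp (\<delta> / 4 * m)"
    using inj \<delta> by (simp add: N_def \<T>_def card_image mult_left_mono)
  then have "ln N \<le> ln ((4 / \<delta>) ^ D * exp (\<delta> / 4 * m))" using N \<delta> by (subst ln_le_cancel_iff) auto
  also have "\<dots> = D * ln (4 / \<delta>) + \<delta> / 4 * m"
    using \<delta> by (simp add: ln_mult ln_realpow)
  also have "\<delta> / 4 * m \<le> \<delta> / 4 * (2 * ln N / \<delta> + 1)" using m \<delta> by (intro mult_left_mono) auto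
  \<comment> \<open>The term \<open>ln N / 2\<close> moves to the left side; doubling the rest gives
    \<open>2 * D * ln (4 / \<delta>)\<close> and \<open>\<delta> / 2 \<le> 1 / 2\<close>.\<close>
  also have "\<dots> = ln N / 2 + \<delta> / 4" using \<delta> by (simp add: field_simps)
  finally show ?thesis using \<delta> by (simp add: N_def)
qed

text \<open>A maximal separated family is a net, since a point left uncovered could be added to it.
  The function \<open>p\<close> is the projection onto this net.\<close>

lemma ex_separated_cover:
  fixes d :: "'b \<Rightarrow> 'b \<Rightarrow> real"
  assumes "finite \<A>" "\<A> \<noteq> {}" and sym: "\<And>x y. d x y = d y x" and "\<And>x. d x x \<le> r"
  obtains \<N> p where "\<N> \<subseteq> \<A>" "\<N> \<noteq> {}" "\<forall>x\<in>\<N>. \<forall>y\<in>\<N>. x \<noteq> y \<longrightarrow> r < d x y"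
    and "\<forall>x\<in>\<A>. p x \<in> \<N> \<and> d x (p x) \<le> r"
proof -
  let ?Q = "{\<N>\<in>Pow \<A>. \<forall>x\<in>\<N>. \<forall>y\<in>\<N>. x \<noteq> y \<longrightarrow> r < d x y}"
  have "finite ?Q" "{} \<in> ?Q" using assms by auto
  then obtain \<N> where \<N>: "\<N> \<in> ?Q" and max: "\<And>\<M>. \<M> \<in> ?Q \<Longrightarrow> \<N> \<subseteq> \<M> \<Longrightarrow> \<N> = \<M>"
    using finite_has_maximal[of ?Q] by (metis (no_types, lifting) empty_iff)
  have cover: "\<exists>y\<in>\<N>. d x y \<le> r" if "x \<in> \<A>" for x
  proof (rule ccontr)
    assume *: "\<not> ?thesis"
    then have far: "r < d x y" "r < d y x" if "y \<in> \<N>" for y using that sym[of x] by (auto simp: not_le)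
    have "insert x \<N> \<in> ?Q"
    proof (rule CollectI, intro conjI ballI impI)
      show "insert x \<N> \<in> Pow \<A>" using \<N> \<open>x \<in> \<A>\<close> by blast
      fix u v assume "u \<in> insert x \<N>" "v \<in> insert x \<N>" "u \<noteq> v"
      then show "r < d u v" using far \<N> by blast
    qed
    then have "x \<in> \<N>" using max[of "insert x \<N>"] by blast
    with * assms show False by blast
  qed
  then have "\<N> \<noteq> {}" using \<open>\<A> \<noteq> {}\<close> by blast
  have "\<forall>x\<in>\<A>. \<exists>y. y \<in> \<N> \<and> d x y \<le> r" using cover by blast
  from bchoice[OF this] obtain p where "\<forall>x\<in>\<A>. p x \<in> \<N> \<and> d x (p x) \<le> r" ..
  then show ?thesis using \<N> \<open>\<N> \<noteq> {}\<close> by (intro that[of \<N> p]) auto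
qed

section \<open>Chaining for Rademacher sums\<close>

text \<open>A subset \<open>T\<close> of \<open>I\<close> encodes a vector of signs, and \<open>rmean I\<close> is the expectation over independent
  uniform signs.\<close>

definition rsign :: "'b set \<Rightarrow> 'b \<Rightarrow> real" where
  "rsign T i = (if i \<in> T then 1 else - 1)"

definition rmean :: "'b set \<Rightarrow> ('b set \<Rightarrow> real) \<Rightarrow> real" where
  "rmean I h = (\<Sum>T\<in>Pow I. h T) / 2 ^ card I"

lemma rmean_mono: "(\<And>T. T \<subseteq> I \<Longrightarrow> h T \<le> k T) \<Longrightarrow> rmean I h \<le> rmean I k"
  unfolding rmean_def by (intro divide_right_mono sum_mono) auto

lemma rmean_add: "rmean I (\<lambda>T. h T + k T) = rmean I h + rmean I k"
  by (simp add: rmean_def sum.distrib add_divide_distrib)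

lemma rmean_cmult: "rmean I (\<lambda>T. a * h T) = a * rmean I h"
  by (simp add: rmean_def sum_distrib_left[symmetric])

lemma rmean_const: "finite I \<Longrightarrow> rmean I (\<lambda>T. a) = a"
  by (simp add: rmean_def card_Pow)

lemma rmean_sum: "rmean I (\<lambda>T. \<Sum>x\<in>X. h x T) = (\<Sum>x\<in>X. rmean I (h x))"
  unfolding rmean_def by (subst sum.swap) (simp add: sum_divide_distrib)

section \<open>Exponential moments of sign sums and the maximal inequality for finite
  families\<close>

lemma exp_plus_exp_minus_le:
  fixes x :: real
  shows "exp x + exp (- x) \<le> 2 * exp (x\<^sup>2 / 2)"
proof -
  \<comment> \<open>This comparison of factorials makes the series of \<open>cosh x\<close>
    dominated term by term by that of \<open>exp (x\<^sup>2 / 2)\<close>.\<close>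
  have f: "2 ^ n * fact n \<le> (fact (2 * n) :: real)" for n
  proof (induction n)
    case (Suc n)
    have "2 ^ Suc n * fact (Suc n) = real (2 * Suc n) * (2 ^ n * fact n)" by simp
    also have "\<dots> \<le> real (2 * Suc n) * fact (2 * n)" by (intro mult_left_mono Suc) auto
    also have "\<dots> \<le> real (2 * Suc n) * (real (Suc (2 * n)) * fact (2 * n))"
      by (intro mult_left_mono) (simp_all add: mult_le_cancel_right1)
    also have "\<dots> = fact (2 * Suc n)" by simp
    finally show ?case .
  qed simp
  have "(\<lambda>n. if even n then x ^ n / fact n else 0) sums cosh x"
    using cosh_converges[of x] by (simp only: real_scaleR_def divide_inverse mult.commute)
  then have "(\<lambda>n. x ^ (2 * n) / fact (2 * n)) sums cosh x"
    by (subst (asm) sums_mono_reindex[of "\<lambda>n. 2 * n", symmetric]) (auto simp: strict_mono_def elim!: evenE)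
  moreover have "(\<lambda>n. (x\<^sup>2 / 2) ^ n / fact n) sums exp (x\<^sup>2 / 2)"
    using exp_converges[of "x\<^sup>2 / 2"] by (simp only: real_scaleR_def divide_inverse mult.commute)
  moreover have "x ^ (2 * n) / fact (2 * n) \<le> (x\<^sup>2 / 2) ^ n / fact n" for n
  proof -
    have "x ^ (2 * n) / fact (2 * n) \<le> x ^ (2 * n) / (2 ^ n * fact n)"
      using f by (intro divide_left_mono) auto
    then show ?thesis by (simp add: power_mult power_divide)
  qed
  ultimately have "cosh x \<le> exp (x\<^sup>2 / 2)" by (rule sums_le[rotated])
  then show ?thesis by (simp add: cosh_field_def)
qed

text \<open>Expanding the product over \<open>i\<close> of \<open>exp (b i) + exp (- b i)\<close>
  gives one term per vector of signs; this identity takes the place of the independence of the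
  signs.\<close>

lemma rmean_exp_le:
  assumes "finite I"
  shows "rmean I (\<lambda>T. exp (\<Sum>i\<in>I. rsign T i * b i)) \<le> exp ((\<Sum>i\<in>I. (b i)\<^sup>2) / 2)"
proof -
  have "(\<Sum>T\<in>Pow I. exp (\<Sum>i\<in>I. rsign T i * b i))
      = (\<Sum>T\<in>Pow I. (\<Prod>i\<in>T. exp (b i)) * (\<Prod>i\<in>I - T. exp (- b i)))"
  proof (rule sum.cong[OF refl])
    fix T assume "T \<in> Pow I"
    then have T: "T \<subseteq> I" by simp
    have "exp (\<Sum>i\<in>I. rsign T i * b i) = (\<Prod>i\<in>I. exp (rsign T i * b i))" using assms by (rule exp_sum)
    also have "\<dots> = (\<Prod>i\<in>I - T. exp (rsign T i * b i)) * (\<Prod>i\<in>T. exp (rsign T i * b i))"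
      using assms T by (rule prod.subset_diff[rotated])
    also have "(\<Prod>i\<in>I - T. exp (rsign T i * b i)) = (\<Prod>i\<in>I - T. exp (- b i))"
      by (intro prod.cong) (auto simp: rsign_def)
    also have "(\<Prod>i\<in>T. exp (rsign T i * b i)) = (\<Prod>i\<in>T. exp (b i))"
      by (intro prod.cong) (auto simp: rsign_def)
    finally show "exp (\<Sum>i\<in>I. rsign T i * b i) = (\<Prod>i\<in>T. exp (b i)) * (\<Prod>i\<in>I - T. exp (- b i))"
      by (simp add: mult.commute)
  qed
  also have "\<dots> = (\<Prod>i\<in>I. exp (b i) + exp (- b i))" using assms by (rule prod_add[symmetric])
  also have "\<dots> \<le> (\<Prod>i\<in>I. 2 * exp ((b i)\<^sup>2 / 2))"
    by (intro prod_mono conjI exp_plus_exp_minus_le add_nonneg_nonneg) auto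
  also have "\<dots> = 2 ^ card I * exp ((\<Sum>i\<in>I. (b i)\<^sup>2) / 2)"
    using assms by (simp add: prod.distrib exp_sum sum_divide_distrib)
  finally show ?thesis by (simp add: rmean_def field_simps)
qed

text \<open>Instead of Jensen's inequality for the logarithm, the tangent bound
  \<open>1 + u \<le> exp u\<close> is used at \<open>\<theta>\<close> times the maximum minus
  \<open>L\<close>. The value of \<open>L\<close> makes the mean of the normalized sum of
  exponentials at most 1, which leaves \<open>L\<close> as a bound for \<open>\<theta>\<close> times
  the mean. Keeping \<open>\<theta>\<close> free keeps the result linear in
  \<open>V\<close>.\<close>

lemma rmean_Max_le:
  assumes I: "finite I" and \<N>: "finite \<N>" "\<N> \<noteq> {}" and \<theta>: "0 < \<theta>"
    and V: "\<And>A. A \<in> \<N> \<Longrightarrow> (\<Sum>i\<in>I. (b A i)\<^sup>2) \<le> V"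
  shows "rmean I (\<lambda>T. Max ((\<lambda>A. \<Sum>i\<in>I. rsign T i * b A i) ` \<N>)) \<le> ln (card \<N>) / \<theta> + \<theta> * V / 2"
proof -
  let ?X = "\<lambda>A T. \<Sum>i\<in>I. rsign T i * b A i"
  let ?M = "\<lambda>T. Max ((\<lambda>A. ?X A T) ` \<N>)"
  define L where "L = ln (card \<N>) + \<theta>\<^sup>2 * V / 2"
  have card: "0 < real (card \<N>)" using \<N> by (simp add: card_gt_0_iff)
  have "\<theta> * ?M T \<le> (\<Sum>A\<in>\<N>. exp (- L) * exp (\<theta> * ?X A T)) + (L - 1)" for T
  proof -
    have "?M T \<in> (\<lambda>A. ?X A T) ` \<N>" using \<N> by (intro Max_in) auto
    then obtain A where A: "A \<in> \<N>" "?M T = ?X A T" by blast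
    have "1 + (\<theta> * ?M T - L) \<le> exp (\<theta> * ?X A T - L)" using A exp_ge_add_one_self[of "\<theta> * ?M T - L"] by simp
    also have "\<dots> = exp (- L) * exp (\<theta> * ?X A T)" by (simp add: exp_add[symmetric])
    also have "\<dots> \<le> (\<Sum>A\<in>\<N>. exp (- L) * exp (\<theta> * ?X A T))"
      using A \<N> by (intro member_le_sum) auto
    finally show ?thesis by simp
  qed
  then have "rmean I (\<lambda>T. \<theta> * ?M T) \<le> rmean I (\<lambda>T. (\<Sum>A\<in>\<N>. exp (- L) * exp (\<theta> * ?X A T)) + (L - 1))"
    by (intro rmean_mono)
  also have "\<dots> = (\<Sum>A\<in>\<N>. exp (- L) * rmean I (\<lambda>T. exp (\<Sum>i\<in>I. rsign T i * (\<theta> * b A i)))) + (L - 1)"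
    using I by (simp add: rmean_add rmean_sum rmean_cmult rmean_const sum_distrib_left mult.left_commute)
  also have "\<dots> \<le> (\<Sum>A\<in>\<N>. exp (- L) * exp (\<theta>\<^sup>2 * V / 2)) + (L - 1)"
  proof (intro add_mono sum_mono mult_left_mono order_refl)
    fix A assume "A \<in> \<N>"
    have "rmean I (\<lambda>T. exp (\<Sum>i\<in>I. rsign T i * (\<theta> * b A i))) \<le> exp ((\<Sum>i\<in>I. (\<theta> * b A i)\<^sup>2) / 2)"
      using I by (rule rmean_exp_le)
    also have "(\<Sum>i\<in>I. (\<theta> * b A i)\<^sup>2) = \<theta>\<^sup>2 * (\<Sum>i\<in>I. (b A i)\<^sup>2)"
      by (simp add: power_mult_distrib sum_distrib_left)
    also have "exp (\<dots> / 2) \<le> exp (\<theta>\<^sup>2 * V / 2)"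
      using V[OF \<open>A \<in> \<N>\<close>] by (simp add: mult_left_mono)
    finally show "rmean I (\<lambda>T. exp (\<Sum>i\<in>I. rsign T i * (\<theta> * b A i))) \<le> exp (\<theta>\<^sup>2 * V / 2)" .
  qed auto
  also have "(\<Sum>A\<in>\<N>. exp (- L) * exp (\<theta>\<^sup>2 * V / 2)) = card \<N> * exp (- ln (card \<N>))"
    by (simp add: L_def exp_add[symmetric])
  also have "\<dots> = 1" using card by (simp add: exp_minus)
  finally have "\<theta> * rmean I ?M \<le> L" by (simp add: rmean_cmult)
  then have "rmean I ?M \<le> L / \<theta>" using \<theta> by (simp add: field_simps)
  also have "\<dots> = ln (card \<N>) / \<theta> + \<theta> * V / 2" using \<theta> by (simp add: L_def field_simps power2_eq_square)
  finally show ?thesis .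
qed

section \<open>Nets of a VC class and chaining along them\<close>

lemma shatters_mono: "shatters \<N> S \<Longrightarrow> \<N> \<subseteq> \<A> \<Longrightarrow> shatters \<A> S"
  unfolding shatters_def by blast

lemma ln_4_le: "ln 4 \<le> (3 / 2 :: real)"
proof -
  have "(4::real) \<le> (1 + 3 / 4 + (3 / 4)\<^sup>2 / 2)\<^sup>2" by (simp add: power2_eq_square)
  also have "\<dots> \<le> (exp (3 / 4))\<^sup>2" by (intro power_mono exp_lower_Taylor_quadratic) auto
  also have "\<dots> = exp (3 / 2)" by (simp add: exp_double[symmetric])
  finally have "ln 4 \<le> ln (exp (3 / 2 :: real))" by (subst ln_le_cancel_iff) auto
  then show ?thesis by simp
qed

lemma sum_indicator_diff_sq:
  fixes v :: "'b \<Rightarrow> real"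
  assumes "finite I" "A \<subseteq> I" "B \<subseteq> I"
  shows "(\<Sum>i\<in>I. ((indicator A i - indicator B i) * v i)\<^sup>2) = (\<Sum>i\<in>sym_diff A B. (v i)\<^sup>2)"
  using assms
  by (intro sum.mono_neutral_cong_right) (auto simp: indicator_def)

text \<open>The radius is measured in squared distance, so each level halves the Euclidean distance
  between the vectors with entries \<open>indicator A i * v i\<close>, while the entropy grows only
  linearly in \<open>k\<close>. This is why the chain converges, like the series of
  \<open>k / 2 ^ k\<close>. The packing bound is used with
  \<open>\<delta> = 1 / 4 ^ k\<close>.\<close>

lemma ex_chaining_net:
  fixes v :: "'b \<Rightarrow> real"
  assumes I: "finite I" and \<A>: "\<A> \<subseteq> Pow I" "\<A> \<noteq> {}" and "1 \<le> D"
    and vc: "\<And>S. S \<subseteq> I \<Longrightarrow> shatters \<A> S \<Longrightarrow> card S \<le> D"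
    and W: "0 < (\<Sum>i\<in>I. (v i)\<^sup>2)"
  obtains \<N> p where "\<N> \<subseteq> \<A>" "\<N> \<noteq> {}" "ln (card \<N>) \<le> D * (3 * real k + 7 / 2)"
    and "\<forall>A\<in>\<A>. p A \<in> \<N> \<and> (\<Sum>i\<in>sym_diff A (p A). (v i)\<^sup>2) \<le> (\<Sum>i\<in>I. (v i)\<^sup>2) / 4 ^ k"
proof -
  let ?w = "\<lambda>i. (v i)\<^sup>2"
  have "finite \<A>" using I \<A> by (meson finite_Pow_iff finite_subset)
  then obtain \<N> p where \<N>: "\<N> \<subseteq> \<A>" "\<N> \<noteq> {}"
      and sep: "\<forall>A\<in>\<N>. \<forall>B\<in>\<N>. A \<noteq> B \<longrightarrow> sum ?w I / 4 ^ k < sum ?w (sym_diff A B)"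
      and cover: "\<forall>A\<in>\<A>. p A \<in> \<N> \<and> sum ?w (sym_diff A (p A)) \<le> sum ?w I / 4 ^ k"
  proof (rule ex_separated_cover[of \<A> "\<lambda>A B. sum ?w (sym_diff A B)" "sum ?w I / 4 ^ k"])
    show "\<A> \<noteq> {}" by fact
    show "sum ?w (sym_diff A B) = sum ?w (sym_diff B A)" for A B by (simp add: Un_commute)
    show "sum ?w (sym_diff A A) \<le> sum ?w I / 4 ^ k" for A using W by simp
  qed
  have "ln (card \<N>) \<le> 2 * real D * ln (4 / (1 / 4 ^ k)) + 1 / 2"
  proof (rule ln_card_packing_le[OF I _ W])
    show "1 / 4 ^ k * sum ?w I \<le> sum ?w (sym_diff A B)" if "A \<in> \<N>" "B \<in> \<N>" "A \<noteq> B" for A B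
    proof -
      have "sum ?w I / 4 ^ k < sum ?w (sym_diff A B)" using sep that by blast
      then show ?thesis by simp
    qed
    show "card S \<le> D" if "S \<subseteq> I" "shatters \<N> S" for S
      using that vc shatters_mono[OF _ \<N>(1)] by blast
  qed (use \<N> \<A> in auto)
  also have "ln (4 / (1 / 4 ^ k)) = (real k + 1) * ln 4"
    using ln_realpow[of 4 "Suc k"] by simp
  \<comment> \<open>The additive \<open>1 / 2\<close> is absorbed into \<open>D / 2\<close>, which
    turns \<open>3 * D\<close> into \<open>7 / 2 * D\<close>.\<close>
  also have "2 * real D * ((real k + 1) * ln 4) \<le> 2 * real D * ((real k + 1) * (3 / 2))"
    using ln_4_le by (intro mult_left_mono) auto
  also have "2 * real D * ((real k + 1) * (3 / 2)) + 1 / 2 \<le> D * (3 * real k + 7 / 2)"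
    using \<open>1 \<le> D\<close> by (simp add: algebra_simps add_divide_distrib)
  finally have "ln (card \<N>) \<le> D * (3 * real k + 7 / 2)" by simp
  then show ?thesis using \<N> cover by (intro that[of \<N> p])
qed

text \<open>The coefficients are partial sums: passing from level \<open>k\<close> to level \<open>k + 1\<close> with parameter \<open>2\<^sup>k\<^sup>+\<^sup>1 \<theta>\<close>
  in the maximal inequality adds \<open>(3 k + 13/2) / 2\<^sup>k\<^sup>+\<^sup>1\<close> and \<open>1 / 2\<^sup>k\<close> respectively.\<close>

lemma rmean_Max_net_le:
  fixes v :: "'b \<Rightarrow> real"
  assumes I: "finite I" and \<A>: "\<A> \<subseteq> Pow I" and D: "1 \<le> D" and \<theta>: "0 < \<theta>"
    and vc: "\<And>S. S \<subseteq> I \<Longrightarrow> shatters \<A> S \<Longrightarrow> card S \<le> D"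
    and W: "0 < (\<Sum>i\<in>I. (v i)\<^sup>2)"
    and \<N>: "\<N> \<subseteq> \<A>" "\<N> \<noteq> {}" "ln (card \<N>) \<le> D * (3 * real k + 7 / 2)"
  shows "rmean I (\<lambda>T. Max ((\<lambda>A. \<Sum>i\<in>A. rsign T i * v i) ` \<N>))
    \<le> (13 - (3 * real k + 19 / 2) / 2 ^ k) * (D / \<theta>) + (5 / 2 - 2 / 2 ^ k) * (\<theta> * (\<Sum>i\<in>I. (v i)\<^sup>2))"
  using \<N>
proof (induction k arbitrary: \<N>)
  let ?W = "\<Sum>i\<in>I. (v i)\<^sup>2"
  let ?X = "\<lambda>A T. \<Sum>i\<in>A. rsign T i * v i"
  have fin: "finite \<N>" if "\<N> \<subseteq> \<A>" for \<N> using that \<A> I by (meson finite_Pow_iff finite_subset)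
  have X: "?X A T = (\<Sum>i\<in>I. rsign T i * (indicator A i * v i))" if "A \<subseteq> I" for A T
    using I that by (intro sum.mono_neutral_cong_left) (auto simp: indicator_def)
  {
    \<comment> \<open>At \<open>k = 0\<close> the closed forms equal \<open>7 / 2\<close> and
      \<open>1 / 2\<close>, exactly what the maximal inequality gives with parameter
      \<open>\<theta>\<close> and \<open>V\<close> the full sum of squares.\<close>
    case 0
    have "(\<lambda>A. ?X A T) ` \<N> = (\<lambda>A. \<Sum>i\<in>I. rsign T i * (indicator A i * v i)) ` \<N>" for T
      using 0 \<A> X by (intro image_cong) auto
    then have "rmean I (\<lambda>T. Max ((\<lambda>A. ?X A T) ` \<N>))
        = rmean I (\<lambda>T. Max ((\<lambda>A. \<Sum>i\<in>I. rsign T i * (indicator A i * v i)) ` \<N>))" by simp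
    also have "\<dots> \<le> ln (card \<N>) / \<theta> + \<theta> * ?W / 2"
      using 0 fin I \<theta> by (intro rmean_Max_le sum_mono) (auto simp: indicator_def)
    also have "ln (card \<N>) / \<theta> \<le> D * (7 / 2) / \<theta>" using 0 \<theta> by (intro divide_right_mono) auto
    finally show ?case by simp
  next
    case (Suc k)
    from Suc.prems have "\<A> \<noteq> {}" by blast
    \<comment> \<open>The family \<open>\<N>\<close> is arbitrary of the given entropy, and the net
      \<open>\<M>\<close> of the previous level approximates it. The increment from
      \<open>p A\<close> to \<open>A\<close> is indexed by \<open>A\<close> alone, so
      \<open>card \<N>\<close> counts the increments, not a product of two cardinalities.\<close>
    obtain \<M> p where \<M>: "\<M> \<subseteq> \<A>" "\<M> \<noteq> {}" "ln (card \<M>) \<le> D * (3 * real k + 7 / 2)"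
      and p: "\<forall>A\<in>\<A>. p A \<in> \<M> \<and> (\<Sum>i\<in>sym_diff A (p A). (v i)\<^sup>2) \<le> ?W / 4 ^ k"
      by (rule ex_chaining_net[where k = k, OF I \<A> \<open>\<A> \<noteq> {}\<close> D vc W])
    let ?b = "\<lambda>A i. (indicator A i - indicator (p A) i) * v i"
    let ?\<theta> = "2 ^ Suc k * \<theta>"
    have "Max ((\<lambda>A. ?X A T) ` \<N>)
        \<le> Max ((\<lambda>A. ?X A T) ` \<M>) + Max ((\<lambda>A. \<Sum>i\<in>I. rsign T i * ?b A i) ` \<N>)" for T
    proof (subst Max_le_iff; (intro ballI)?)
      fix x assume "x \<in> (\<lambda>A. ?X A T) ` \<N>"
      then obtain A where A: "A \<in> \<N>" "x = ?X A T" by blast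
      then have "A \<in> \<A>" "p A \<in> \<M>" "A \<subseteq> I" "p A \<subseteq> I" using Suc.prems p \<A> \<M> by auto
      have "x = ?X (p A) T + (\<Sum>i\<in>I. rsign T i * ?b A i)"
        unfolding A X[OF \<open>A \<subseteq> I\<close>] X[OF \<open>p A \<subseteq> I\<close>] sum.distrib[symmetric]
        by (intro sum.cong) (auto simp: algebra_simps)
      also have "\<dots> \<le> Max ((\<lambda>A. ?X A T) ` \<M>) + Max ((\<lambda>A. \<Sum>i\<in>I. rsign T i * ?b A i) ` \<N>)"
        using A \<open>p A \<in> \<M>\<close> fin \<M> Suc.prems by (intro add_mono Max_ge) auto
      finally show "x \<le> \<dots>" .
    qed (use fin Suc.prems in auto)
    then have "rmean I (\<lambda>T. Max ((\<lambda>A. ?X A T) ` \<N>)) \<le> rmean I (\<lambda>T. Max ((\<lambda>A. ?X A T) ` \<M>))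
        + rmean I (\<lambda>T. Max ((\<lambda>A. \<Sum>i\<in>I. rsign T i * ?b A i) ` \<N>))"
      unfolding rmean_add[symmetric] by (rule rmean_mono)
    also have "rmean I (\<lambda>T. Max ((\<lambda>A. \<Sum>i\<in>I. rsign T i * ?b A i) ` \<N>))
        \<le> ln (card \<N>) / ?\<theta> + ?\<theta> * (?W / 4 ^ k) / 2"
    proof (rule rmean_Max_le[OF I])
      fix A assume "A \<in> \<N>"
      then have "A \<in> \<A>" "A \<subseteq> I" "p A \<subseteq> I" using Suc.prems p \<A> \<M> by auto
      then show "(\<Sum>i\<in>I. (?b A i)\<^sup>2) \<le> ?W / 4 ^ k"
        using p \<open>A \<in> \<A>\<close> by (simp add: sum_indicator_diff_sq[OF I])
    qed (use Suc.prems fin \<theta> in auto)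
    also have "rmean I (\<lambda>T. Max ((\<lambda>A. ?X A T) ` \<M>))
        \<le> (13 - (3 * real k + 19 / 2) / 2 ^ k) * (D / \<theta>) + (5 / 2 - 2 / 2 ^ k) * (\<theta> * ?W)"
      by (rule Suc.IH[OF \<M>])
    also have "ln (card \<N>) / ?\<theta> \<le> (D * (3 * real (Suc k) + 7 / 2)) / ?\<theta>"
      using \<theta> Suc.prems by (intro divide_right_mono) auto
    also have "\<dots> = (3 * real k + 13 / 2) / 2 ^ k / 2 * (D / \<theta>)" by (simp add: field_simps)
    also have "?\<theta> * (?W / 4 ^ k) / 2 = 1 / 2 ^ k * (\<theta> * ?W)"
    proof -
      have "(4::real) ^ k = 2 ^ k * 2 ^ k" by (simp add: power_mult_distrib[symmetric])
      then show ?thesis by simp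
    qed
    finally have "rmean I (\<lambda>T. Max ((\<lambda>A. ?X A T) ` \<N>))
        \<le> (13 - (3 * real k + 19 / 2) / 2 ^ k + (3 * real k + 13 / 2) / 2 ^ k / 2) * (D / \<theta>)
          + (5 / 2 - 2 / 2 ^ k + 1 / 2 ^ k) * (\<theta> * ?W)"
      by (simp only: distrib_right) linarith
    also have "13 - (3 * real k + 19 / 2) / 2 ^ k + (3 * real k + 13 / 2) / 2 ^ k / 2 = 13 - (3 * real (Suc k) + 19 / 2) / 2 ^ Suc k"
      by (simp add: field_simps)
    also have "5 / 2 - 2 / 2 ^ k + 1 / 2 ^ k = (5 / 2 - 2 / 2 ^ Suc k :: real)" by (simp add: field_simps)
    finally show ?case .
  }
qed

text \<open>No limit in \<open>k\<close> is needed: once the radius is below every nonzero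
  \<open>(v i)\<^sup>2\<close>, a set and its projection differ only at indices where
  \<open>v\<close> vanishes, so they give the same sum. The constants are the values of the full
  series, \<open>13 = 7/2 + 3 + 13/2\<close> and \<open>5/2 = 1/2 + 2\<close>.\<close>

lemma rmean_Max_class_le:
  fixes v :: "'b \<Rightarrow> real"
  assumes I: "finite I" and \<A>: "\<A> \<subseteq> Pow I" "\<A> \<noteq> {}" and D: "1 \<le> D" and \<theta>: "0 < \<theta>"
    and vc: "\<And>S. S \<subseteq> I \<Longrightarrow> shatters \<A> S \<Longrightarrow> card S \<le> D"
  shows "rmean I (\<lambda>T. Max ((\<lambda>A. \<Sum>i\<in>A. rsign T i * v i) ` \<A>))
    \<le> 13 * (D / \<theta>) + 5 / 2 * (\<theta> * (\<Sum>i\<in>I. (v i)\<^sup>2))"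
proof (cases "(\<Sum>i\<in>I. (v i)\<^sup>2) = 0")
  case True
  then have "v i = 0" if "i \<in> I" for i using that I by (simp add: sum_nonneg_eq_0_iff)
  then have "(\<Sum>i\<in>A. rsign T i * v i) = 0" if "A \<in> \<A>" for A T
    using that \<A> by (intro sum.neutral) auto
  then have "(\<lambda>A. \<Sum>i\<in>A. rsign T i * v i) ` \<A> = {0}" for T using \<A> by auto
  then show ?thesis using True I \<theta> by (simp add: rmean_const)
next
  case False
  let ?W = "\<Sum>i\<in>I. (v i)\<^sup>2"
  have W: "0 < ?W" using False by (simp add: less_le sum_nonneg)
  \<comment> \<open>The inserted \<open>1\<close> makes \<open>Min\<close> range over a nonempty set
    of positive numbers in any case.\<close>
  define e where "e = Min (insert 1 ((\<lambda>i. (v i)\<^sup>2) ` {i\<in>I. v i \<noteq> 0}))"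
  have e: "0 < e" "\<And>i. i \<in> I \<Longrightarrow> v i \<noteq> 0 \<Longrightarrow> e \<le> (v i)\<^sup>2"
    unfolding e_def using I by (subst Min_gr_iff, auto intro: Min_le)
  obtain k where k: "?W / e < 4 ^ k" using real_arch_pow[of 4 "?W / e"] by auto
  then have k: "?W / 4 ^ k < e" using e by (simp add: field_simps)
  obtain \<N> p where \<N>: "\<N> \<subseteq> \<A>" "\<N> \<noteq> {}" "ln (card \<N>) \<le> D * (3 * real k + 7 / 2)"
    and p: "\<forall>A\<in>\<A>. p A \<in> \<N> \<and> (\<Sum>i\<in>sym_diff A (p A). (v i)\<^sup>2) \<le> ?W / 4 ^ k"
    by (rule ex_chaining_net[where k = k, OF I \<A> D vc W])
  have fin: "finite \<A>" "finite \<N>" using \<N> \<A> I by (meson finite_Pow_iff finite_subset)+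
  have "Max ((\<lambda>A. \<Sum>i\<in>A. rsign T i * v i) ` \<A>) \<le> Max ((\<lambda>A. \<Sum>i\<in>A. rsign T i * v i) ` \<N>)" for T
  proof (subst Max_le_iff; (intro ballI)?)
    fix x assume "x \<in> (\<lambda>A. \<Sum>i\<in>A. rsign T i * v i) ` \<A>"
    then obtain A where A: "A \<in> \<A>" "x = (\<Sum>i\<in>A. rsign T i * v i)" by blast
    define B where "B = p A"
    then have B: "B \<in> \<N>" "(\<Sum>i\<in>sym_diff A B. (v i)\<^sup>2) \<le> ?W / 4 ^ k" using p A by auto
    have sub: "A \<subseteq> I" "B \<subseteq> I" using A B \<A> \<N> by auto
    have z: "v i = 0" if "i \<in> sym_diff A B" for i
    proof (rule ccontr)
      assume "v i \<noteq> 0"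
      then have "e \<le> (v i)\<^sup>2" using that sub e by auto
      also have "\<dots> \<le> (\<Sum>i\<in>sym_diff A B. (v i)\<^sup>2)"
        using that sub I by (intro member_le_sum) (auto intro: finite_subset)
      finally show False using B k by simp
    qed
    have "x = (\<Sum>i\<in>A \<inter> B. rsign T i * v i)" "(\<Sum>i\<in>B. rsign T i * v i) = (\<Sum>i\<in>A \<inter> B. rsign T i * v i)"
      unfolding A using sub I by (auto intro!: sum.mono_neutral_right z intro: finite_subset)
    then show "x \<le> Max ((\<lambda>A. \<Sum>i\<in>A. rsign T i * v i) ` \<N>)"
      using B fin by (auto intro!: Max_ge image_eqI[of _ _ B])
  qed (use fin \<A> in auto)
  then have "rmean I (\<lambda>T. Max ((\<lambda>A. \<Sum>i\<in>A. rsign T i * v i) ` \<A>))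
      \<le> rmean I (\<lambda>T. Max ((\<lambda>A. \<Sum>i\<in>A. rsign T i * v i) ` \<N>))" by (rule rmean_mono)
  also have "\<dots> \<le> (13 - (3 * real k + 19 / 2) / 2 ^ k) * (D / \<theta>) + (5 / 2 - 2 / 2 ^ k) * (\<theta> * ?W)"
    by (rule rmean_Max_net_le[OF I \<A>(1) D \<theta> vc W \<N>(1-3)])
  also have "\<dots> \<le> 13 * (D / \<theta>) + 5 / 2 * (\<theta> * ?W)"
    using \<theta> W by (intro add_mono mult_right_mono) auto
  finally show ?thesis .
qed

lemma powr_split_le:
  fixes a t p :: real
  assumes "0 < t" "1 \<le> p" "p \<le> 2" "0 \<le> a"
  shows "a \<le> t \<Longrightarrow> a\<^sup>2 / t \<le> t powr (1 - p) * a powr p"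
    and "t < a \<Longrightarrow> a \<le> t powr (1 - p) * a powr p"
proof -
  assume "a \<le> t"
  show "a\<^sup>2 / t \<le> t powr (1 - p) * a powr p"
  proof (cases "a = 0")
    case False
    then have "0 < a" using assms by simp
    then have "a\<^sup>2 / t = a powr (2 - p) * a powr p / t" by (simp add: powr_add[symmetric] powr_numeral)
    \<comment> \<open>Here the exponent \<open>2 - p\<close> is nonnegative and the power increases;
      for \<open>t < a\<close> the exponent \<open>1 - p\<close> is nonpositive and the power
      decreases. Both cases end at the same expression.\<close>
    also have "\<dots> \<le> t powr (2 - p) * a powr p / t"
      using assms \<open>a \<le> t\<close> by (intro divide_right_mono mult_right_mono powr_mono2) auto
    also have "t powr (2 - p) = t powr (1 - p) * t" using assms powr_add[of t "1 - p" 1] by simp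
    finally show ?thesis using assms by simp
  qed simp
next
  assume "t < a"
  have "a = a powr (1 - p) * a powr p" using assms \<open>t < a\<close> by (simp add: powr_add[symmetric])
  also have "\<dots> \<le> t powr (1 - p) * a powr p"
    using assms \<open>t < a\<close> by (intro mult_right_mono powr_mono2') auto
  finally show "a \<le> t powr (1 - p) * a powr p" .
qed

text \<open>The coefficients of size at most \<open>t\<close> are chained with
  \<open>\<theta> = 1 / t\<close>; the large ones are bounded by the sum of their absolute values,
  uniformly over the class and the signs.\<close>

lemma rmean_Max_class_powr_le:
  fixes v :: "'b \<Rightarrow> real" and t p :: real
  assumes I: "finite I" and \<A>: "\<A> \<subseteq> Pow I" "\<A> \<noteq> {}" and D: "1 \<le> D" and t: "0 < t"
    and p: "1 \<le> p" "p \<le> 2"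
    and vc: "\<And>S. S \<subseteq> I \<Longrightarrow> shatters \<A> S \<Longrightarrow> card S \<le> D"
  shows "rmean I (\<lambda>T. Max ((\<lambda>A. \<Sum>i\<in>A. rsign T i * v i) ` \<A>))
    \<le> 13 * (D * t) + 5 / 2 * (t powr (1 - p) * (\<Sum>i\<in>I. \<bar>v i\<bar> powr p))"
proof -
  define u where "u i = (if \<bar>v i\<bar> \<le> t then v i else 0)" for i
  define r where "r i = (if \<bar>v i\<bar> \<le> t then 0 else v i)" for i
  have v: "v i = u i + r i" for i by (simp add: u_def r_def)
  have fin: "finite \<A>" using \<A> I by (meson finite_Pow_iff finite_subset)
  have "Max ((\<lambda>A. \<Sum>i\<in>A. rsign T i * v i) ` \<A>)
      \<le> Max ((\<lambda>A. \<Sum>i\<in>A. rsign T i * u i) ` \<A>) + (\<Sum>i\<in>I. \<bar>r i\<bar>)" for T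
  proof (subst Max_le_iff; (intro ballI)?)
    fix x assume "x \<in> (\<lambda>A. \<Sum>i\<in>A. rsign T i * v i) ` \<A>"
    then obtain A where A: "A \<in> \<A>" "x = (\<Sum>i\<in>A. rsign T i * v i)" by blast
    then have "x = (\<Sum>i\<in>A. rsign T i * u i) + (\<Sum>i\<in>A. rsign T i * r i)"
      by (simp add: v sum.distrib[symmetric] algebra_simps)
    also have "(\<Sum>i\<in>A. rsign T i * r i) \<le> (\<Sum>i\<in>A. \<bar>r i\<bar>)"
      by (intro sum_mono) (auto simp: rsign_def)
    also have "\<dots> \<le> (\<Sum>i\<in>I. \<bar>r i\<bar>)" using A \<A> I by (intro sum_mono2) auto
    also have "(\<Sum>i\<in>A. rsign T i * u i) \<le> Max ((\<lambda>A. \<Sum>i\<in>A. rsign T i * u i) ` \<A>)"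
      using A fin by (intro Max_ge) auto
    finally show "x \<le> Max ((\<lambda>A. \<Sum>i\<in>A. rsign T i * u i) ` \<A>) + (\<Sum>i\<in>I. \<bar>r i\<bar>)" by simp
  qed (use fin \<A> in auto)
  then have "rmean I (\<lambda>T. Max ((\<lambda>A. \<Sum>i\<in>A. rsign T i * v i) ` \<A>))
      \<le> rmean I (\<lambda>T. Max ((\<lambda>A. \<Sum>i\<in>A. rsign T i * u i) ` \<A>) + (\<Sum>i\<in>I. \<bar>r i\<bar>))"
    by (rule rmean_mono)
  also have "\<dots> = rmean I (\<lambda>T. Max ((\<lambda>A. \<Sum>i\<in>A. rsign T i * u i) ` \<A>)) + (\<Sum>i\<in>I. \<bar>r i\<bar>)"
    using I by (simp add: rmean_add rmean_const)
  finally have *: "rmean I (\<lambda>T. Max ((\<lambda>A. \<Sum>i\<in>A. rsign T i * v i) ` \<A>))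
      \<le> rmean I (\<lambda>T. Max ((\<lambda>A. \<Sum>i\<in>A. rsign T i * u i) ` \<A>)) + (\<Sum>i\<in>I. \<bar>r i\<bar>)" .
  have **: "rmean I (\<lambda>T. Max ((\<lambda>A. \<Sum>i\<in>A. rsign T i * u i) ` \<A>))
      \<le> 13 * (D / (1 / t)) + 5 / 2 * (1 / t * (\<Sum>i\<in>I. (u i)\<^sup>2))"
    using t by (intro rmean_Max_class_le[OF I \<A> D _ vc]) auto
  have "5 / 2 * (1 / t * (\<Sum>i\<in>I. (u i)\<^sup>2)) + (\<Sum>i\<in>I. \<bar>r i\<bar>) = (\<Sum>i\<in>I. 5 / 2 * ((u i)\<^sup>2 / t) + \<bar>r i\<bar>)"
    by (simp add: sum.distrib sum_distrib_left sum_divide_distrib)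
  \<comment> \<open>Each index feeds only one of the two terms: a small coefficient the square, a
    large one the remainder, whose factor 1 is rounded up to \<open>5 / 2\<close>.\<close>
  also have "\<dots> \<le> (\<Sum>i\<in>I. 5 / 2 * (t powr (1 - p) * \<bar>v i\<bar> powr p))"
  proof (rule sum_mono)
    fix i
    show "5 / 2 * ((u i)\<^sup>2 / t) + \<bar>r i\<bar> \<le> 5 / 2 * (t powr (1 - p) * \<bar>v i\<bar> powr p)"
    proof (cases "\<bar>v i\<bar> \<le> t")
      case True
      then show ?thesis using powr_split_le(1)[OF t p, of "\<bar>v i\<bar>"] by (simp add: u_def r_def)
    next
      case False
      then show ?thesis using powr_split_le(2)[OF t p, of "\<bar>v i\<bar>"] by (simp add: u_def r_def)
    qed
  qed
  finally show ?thesis using * ** by (simp add: sum_distrib_left)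
qed

section \<open>Symmetrization\<close>

text \<open>Reversing all signs permutes the sign vectors. In the symmetrization, the independent
  copy enters with the reversed signs.\<close>

lemma rmean_complement: "rmean I (\<lambda>T. h (I - T)) = rmean I h"
proof -
  have "bij_betw (\<lambda>T. I - T) (Pow I) (Pow I)"
    by (rule bij_betw_byWitness[where f' = "\<lambda>T. I - T"]) auto
  from sum.reindex_bij_betw[OF this, of h] show ?thesis by (simp add: rmean_def)
qed

lemma integrable_rmean: "(\<And>T. T \<subseteq> I \<Longrightarrow> integrable M (h T)) \<Longrightarrow> integrable M (\<lambda>x. rmean I (\<lambda>T. h T x))"
  unfolding rmean_def by (intro integrable_divide Bochner_Integration.integrable_sum) auto

lemma integral_rmean:
  "(\<And>T. T \<subseteq> I \<Longrightarrow> integrable M (h T)) \<Longrightarrow> (\<integral>x. rmean I (\<lambda>T. h T x) \<partial>M) = rmean I (\<lambda>T. \<integral>x. h T x \<partial>M)"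
  unfolding rmean_def by (subst Bochner_Integration.integral_divide_zero, subst Bochner_Integration.integral_sum) auto

lemma integrable_PiM_component:
  fixes N :: "'i \<Rightarrow> real measure"
  assumes "\<And>i. i \<in> K \<Longrightarrow> prob_space (N i)" "\<And>i. i \<in> K \<Longrightarrow> integrable (N i) (\<lambda>x. x)" "i \<in> K"
  shows "integrable (Pi\<^sub>M K N) (\<lambda>\<omega>. \<omega> i)" and "(\<integral>\<omega>. \<omega> i \<partial>Pi\<^sub>M K N) = (\<integral>x. x \<partial>N i)"
proof -
  have d: "distr (Pi\<^sub>M K N) (N i) (\<lambda>\<omega>. \<omega> i) = N i" using assms by (intro distr_PiM_component) auto
  have m: "(\<lambda>x. x) \<in> borel_measurable (N i)" using assms(2,3) by auto
  have "integrable (distr (Pi\<^sub>M K N) (N i) (\<lambda>\<omega>. \<omega> i)) (\<lambda>x. x)" unfolding d using assms by auto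
  then show "integrable (Pi\<^sub>M K N) (\<lambda>\<omega>. \<omega> i)"
    by (rule integrable_distr[rotated]) (use assms in auto)
  have "(\<integral>x. x \<partial>distr (Pi\<^sub>M K N) (N i) (\<lambda>\<omega>. \<omega> i)) = (\<integral>\<omega>. \<omega> i \<partial>Pi\<^sub>M K N)"
    using m assms by (intro integral_distr) auto
  then show "(\<integral>\<omega>. \<omega> i \<partial>Pi\<^sub>M K N) = (\<integral>x. x \<partial>N i)" unfolding d ..
qed

text \<open>It serves two purposes: the injections \<open>i \<mapsto> (i, b)\<close> extract one
  sample from the doubled product space, and permutations of the doubled index set exchange the two
  samples.\<close>

lemma integral_PiM_reindex:
  fixes g :: "('j \<Rightarrow> 'b) \<Rightarrow> real"
  assumes "\<And>i. i \<in> K \<Longrightarrow> prob_space (N i)" "inj_on f J" "f \<in> J \<rightarrow> K"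
    and g: "g \<in> borel_measurable (Pi\<^sub>M J (\<lambda>j. N (f j)))"
  shows "(\<integral>\<omega>. g (\<lambda>j\<in>J. \<omega> (f j)) \<partial>Pi\<^sub>M K N) = integral\<^sup>L (Pi\<^sub>M J (\<lambda>j. N (f j))) g"
proof -
  have "(\<lambda>\<omega>. \<lambda>j\<in>J. \<omega> (f j)) \<in> measurable (Pi\<^sub>M K N) (Pi\<^sub>M J (\<lambda>j. N (f j)))"
    using assms(3) by (intro measurable_restrict measurable_component_singleton) auto
  from integral_distr[OF this g] distr_PiM_reindex[of K N f J, OF assms(1-3)] show ?thesis by simp
qed

text \<open>Subtracting an independent centred copy can only raise the mean of the maximum, and the
  differences have a symmetric law, so any signs may be inserted. Separating the two samples again,
  by subadditivity of \<open>Max\<close>, costs the factor 2.\<close>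

lemma symmetrization:
  fixes N :: "'i \<Rightarrow> real measure"
  assumes I: "finite I" and \<A>: "\<A> \<subseteq> Pow I" "\<A> \<noteq> {}"
    and N: "\<And>i. prob_space (N i)" "\<And>i. integrable (N i) (\<lambda>x. x)" "\<And>i. (\<integral>x. x \<partial>N i) = 0"
  shows "(\<integral>v. Max ((\<lambda>A. \<Sum>i\<in>A. v i) ` \<A>) \<partial>Pi\<^sub>M I N)
    \<le> 2 * rmean I (\<lambda>T. \<integral>v. Max ((\<lambda>A. \<Sum>i\<in>A. rsign T i * v i) ` \<A>) \<partial>Pi\<^sub>M I N)"
proof -
  interpret N: prob_space "N i" for i by (rule N)
  \<comment> \<open>\<open>\<omega> (i, True)\<close> is the sample and \<open>\<omega> (i, False)\<close> an independent copy of it; changing the sign of the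
    \<open>i\<close>-th difference amounts to exchanging the two.\<close>
  define L where "L = (\<lambda>p::'i \<times> bool. N (fst p))"
  interpret L: prob_space "L p" for p unfolding L_def by (rule N)
  interpret product_prob_space L "I \<times> UNIV" ..
  have L_int: "integrable (L p) (\<lambda>x. x)" "(\<integral>x. x \<partial>L p) = 0" for p by (simp_all add: L_def N)
  define K where "K b = I \<times> {b}" for b :: bool
  define R where "R = Pi\<^sub>M (I \<times> UNIV) L"
  have fin: "finite \<A>" using I \<A> by (meson finite_Pow_iff finite_subset)
  define m where "m T = (\<integral>v. Max ((\<lambda>A. \<Sum>i\<in>A. rsign T i * v i) ` \<A>) \<partial>Pi\<^sub>M I N)" for T
  define H where "H T \<omega> = Max ((\<lambda>A. \<Sum>i\<in>A. rsign T i * (\<omega> (i, True) - \<omega> (i, False))) ` \<A>)"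
    for T and \<omega> :: "'i \<times> bool \<Rightarrow> real"
  have comp: "integrable R (\<lambda>\<omega>. \<omega> (i, b))" if "i \<in> I" for i b
    unfolding R_def using that L_int by (intro integrable_PiM_component L.prob_space_axioms) auto
  have mem: "i \<in> I" if "i \<in> A" "A \<in> \<A>" for i A using that \<A> by auto
  have H_int: "integrable R (H T)" for T unfolding H_def
    using \<A> fin mem by (intro integrable_MAX Bochner_Integration.integrable_sum integrable_mult_right
      Bochner_Integration.integrable_diff comp) auto
  have coord: "integrable (Pi\<^sub>M I N) (\<lambda>v. v i)" if "i \<in> I" for i
    using that N by (intro integrable_PiM_component) auto
  have plain_meas: "(\<lambda>v. Max ((\<lambda>A. \<Sum>i\<in>A. v i) ` \<A>)) \<in> borel_measurable (Pi\<^sub>M I N)"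
    using \<A> fin mem
    by (intro borel_measurable_integrable integrable_MAX Bochner_Integration.integrable_sum coord) auto
  have sign_meas: "(\<lambda>v. Max ((\<lambda>A. \<Sum>i\<in>A. rsign T i * v i) ` \<A>)) \<in> borel_measurable (Pi\<^sub>M I N)" for T
    using \<A> fin mem
    by (intro borel_measurable_integrable integrable_MAX Bochner_Integration.integrable_sum
      integrable_mult_right coord) auto
  have one: "(\<integral>v. Max ((\<lambda>A. \<Sum>i\<in>A. v i) ` \<A>) \<partial>Pi\<^sub>M I N) \<le> integral\<^sup>L R (H I)"
  proof -
    let ?P = "\<lambda>b. Pi\<^sub>M (K b) L"
    have disj: "K True \<inter> K False = {}" "finite (K True)" "finite (K False)" "K True \<union> K False = I \<times> UNIV"
      using I by (auto simp: K_def)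
    interpret PT: prob_space "?P True" by (intro prob_space_PiM L.prob_space_axioms)
    interpret PF: prob_space "?P False" by (intro prob_space_PiM L.prob_space_axioms)
    interpret P: pair_sigma_finite "?P True" "?P False" ..
    let ?M = "merge (K True) (K False)"
    have dm: "distr (?P True \<Otimes>\<^sub>M ?P False) R ?M = R"
      using distr_merge[OF disj(1-3)] disj(4) by (simp add: R_def)
    have mm: "?M \<in> measurable (?P True \<Otimes>\<^sub>M ?P False) R"
      using measurable_merge[of "K True" "K False" L] disj(4) by (simp add: R_def)
    have int: "integrable (?P True \<Otimes>\<^sub>M ?P False) (\<lambda>z. H I (?M z))"
      using mm by (rule integrable_distr) (simp add: dm H_int)
    have HM: "H I (?M (x, y)) = Max ((\<lambda>A. \<Sum>i\<in>A. x (i, True) - y (i, False)) ` \<A>)" for x y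
      unfolding H_def using mem
      by (intro arg_cong[where f = Max] image_cong sum.cong) (auto simp: rsign_def merge_def K_def)
    have cT: "integrable (?P True) (\<lambda>\<omega>. \<omega> (i, True))"
      and cF: "integrable (?P False) (\<lambda>\<omega>. \<omega> (i, False))" "(\<integral>\<omega>. \<omega> (i, False) \<partial>?P False) = 0" if "i \<in> I" for i
      using that L_int L.prob_space_axioms integrable_PiM_component[of "K True" L "(i, True)"]
        integrable_PiM_component[of "K False" L "(i, False)"]
      by (auto simp: K_def)
    have "(\<integral>v. Max ((\<lambda>A. \<Sum>i\<in>A. v i) ` \<A>) \<partial>Pi\<^sub>M I N)
        = (\<integral>\<omega>. Max ((\<lambda>A. \<Sum>i\<in>A. \<omega> (i, True)) ` \<A>) \<partial>?P True)"
    proof -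
      have "(\<integral>\<omega>. Max ((\<lambda>A. \<Sum>i\<in>A. (\<lambda>j\<in>I. \<omega> (j, True)) i) ` \<A>) \<partial>?P True)
          = (\<integral>v. Max ((\<lambda>A. \<Sum>i\<in>A. v i) ` \<A>) \<partial>Pi\<^sub>M I N)"
        using plain_meas N(1) integral_PiM_reindex[of "K True" L "\<lambda>i. (i, True)" I "\<lambda>v. Max ((\<lambda>A. \<Sum>i\<in>A. v i) ` \<A>)"]
        by (auto simp: L.prob_space_axioms L_def K_def inj_on_def)
      moreover have "(\<lambda>A. \<Sum>i\<in>A. (\<lambda>j\<in>I. \<omega> (j, True)) i) ` \<A> = (\<lambda>A. \<Sum>i\<in>A. \<omega> (i, True)) ` \<A>"
        for \<omega> :: "'i \<times> bool \<Rightarrow> real"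
        using mem by (intro image_cong sum.cong) auto
      ultimately show ?thesis by simp
    qed
    also have "\<dots> \<le> (\<integral>x. (\<integral>y. H I (?M (x, y)) \<partial>?P False) \<partial>?P True)"
    proof (rule integral_mono)
      show "integrable (?P True) (\<lambda>\<omega>. Max ((\<lambda>A. \<Sum>i\<in>A. \<omega> (i, True)) ` \<A>))"
        using \<A> fin mem by (intro integrable_MAX Bochner_Integration.integrable_sum cT) auto
      show "integrable (?P True) (\<lambda>x. \<integral>y. H I (?M (x, y)) \<partial>?P False)"
        using P.integrable_fst'[OF int] by simp
      fix x :: "'i \<times> bool \<Rightarrow> real"
      show "Max ((\<lambda>A. \<Sum>i\<in>A. x (i, True)) ` \<A>) \<le> (\<integral>y. H I (?M (x, y)) \<partial>?P False)"
      proof (subst Max_le_iff; (intro ballI)?)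
        fix u assume "u \<in> (\<lambda>A. \<Sum>i\<in>A. x (i, True)) ` \<A>"
        then obtain A where A: "A \<in> \<A>" "u = (\<Sum>i\<in>A. x (i, True))" by blast
        have d: "integrable (?P False) (\<lambda>y. \<Sum>i\<in>B. x (i, True) - y (i, False))" if "B \<in> \<A>" for B
          using that mem by (intro Bochner_Integration.integrable_sum Bochner_Integration.integrable_diff)
            (auto intro: cF(1))
        \<comment> \<open>Jensen's inequality by hand: as the copy is centred, the sum over
          \<open>A\<close> is the mean in \<open>y\<close> of the differences, each of which lies
          below the maximum.\<close>
        have "u = (\<integral>y. (\<Sum>i\<in>A. x (i, True) - y (i, False)) \<partial>?P False)"
          using A mem cF PF.prob_space by (subst Bochner_Integration.integral_sum) (auto simp: Bochner_Integration.integral_diff)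
        also have "\<dots> \<le> (\<integral>y. H I (?M (x, y)) \<partial>?P False)"
          unfolding HM using A fin \<A> d
          by (intro integral_mono integrable_MAX Max_ge) auto
        finally show "u \<le> (\<integral>y. H I (?M (x, y)) \<partial>?P False)" .
      qed (use fin \<A> in auto)
    qed
    also have "\<dots> = (\<integral>z. H I (?M z) \<partial>(?P True \<Otimes>\<^sub>M ?P False))" by (rule P.integral_fst'[OF int])
    also have "\<dots> = integral\<^sup>L (distr (?P True \<Otimes>\<^sub>M ?P False) R ?M) (H I)"
      using mm H_int by (intro integral_distr[symmetric]) auto
    finally show ?thesis unfolding dm .
  qed
  \<comment> \<open>\<open>?f\<close> exchanges the two samples at the indices outside
    \<open>T\<close>; since \<open>L\<close> ignores the Boolean, the product law is
    invariant.\<close>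
  have two: "integral\<^sup>L R (H I) = integral\<^sup>L R (H T)" if "T \<subseteq> I" for T
  proof -
    let ?f = "\<lambda>(i, b). (i :: 'i, if i \<in> T then b else \<not> b)"
    have f: "inj_on ?f (I \<times> UNIV)" "?f \<in> I \<times> UNIV \<rightarrow> I \<times> UNIV" by (auto simp: inj_on_def split: if_splits)
    have Lf: "(\<lambda>j. L (?f j)) = L" by (auto simp: L_def fun_eq_iff)
    have "(\<integral>\<omega>. H I (\<lambda>j\<in>I \<times> UNIV. \<omega> (?f j)) \<partial>R) = integral\<^sup>L R (H I)"
      using integral_PiM_reindex[of "I \<times> UNIV" L ?f "I \<times> UNIV" "H I", OF L.prob_space_axioms f] H_int[of I]
      unfolding Lf R_def by auto
    moreover have "H I (\<lambda>j\<in>I \<times> UNIV. \<omega> (?f j)) = H T \<omega>" for \<omega>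
      unfolding H_def using mem
      by (intro arg_cong[where f = Max] image_cong sum.cong) (auto simp: rsign_def)
    ultimately show ?thesis by simp
  qed
  have m_eq: "(\<integral>\<omega>. Max ((\<lambda>A. \<Sum>i\<in>A. rsign T i * \<omega> (i, b)) ` \<A>) \<partial>R) = m T"
    and m_int: "integrable R (\<lambda>\<omega>. Max ((\<lambda>A. \<Sum>i\<in>A. rsign T i * \<omega> (i, b)) ` \<A>))" for T b
  proof -
    have "(\<integral>\<omega>. Max ((\<lambda>A. \<Sum>i\<in>A. rsign T i * (\<lambda>j\<in>I. \<omega> (j, b)) i) ` \<A>) \<partial>R) = m T"
      unfolding m_def R_def
      using sign_meas[of T] N(1) integral_PiM_reindex[of "I \<times> UNIV" L "\<lambda>i. (i, b)" I "\<lambda>v. Max ((\<lambda>A. \<Sum>i\<in>A. rsign T i * v i) ` \<A>)"]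
      by (auto simp: L.prob_space_axioms L_def inj_on_def)
    moreover have "(\<lambda>A. \<Sum>i\<in>A. rsign T i * (\<lambda>j\<in>I. \<omega> (j, b)) i) ` \<A> = (\<lambda>A. \<Sum>i\<in>A. rsign T i * \<omega> (i, b)) ` \<A>"
      for \<omega> :: "'i \<times> bool \<Rightarrow> real"
      using mem by (intro image_cong sum.cong) auto
    ultimately show "(\<integral>\<omega>. Max ((\<lambda>A. \<Sum>i\<in>A. rsign T i * \<omega> (i, b)) ` \<A>) \<partial>R) = m T" by simp
    show "integrable R (\<lambda>\<omega>. Max ((\<lambda>A. \<Sum>i\<in>A. rsign T i * \<omega> (i, b)) ` \<A>))"
      using \<A> fin mem by (intro integrable_MAX Bochner_Integration.integrable_sum integrable_mult_right comp) auto
  qed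
  have three: "integral\<^sup>L R (H T) \<le> m T + m (I - T)" if "T \<subseteq> I" for T
  proof -
    have "H T \<omega> \<le> Max ((\<lambda>A. \<Sum>i\<in>A. rsign T i * \<omega> (i, True)) ` \<A>)
        + Max ((\<lambda>A. \<Sum>i\<in>A. rsign (I - T) i * \<omega> (i, False)) ` \<A>)" for \<omega>
      unfolding H_def
    proof (subst Max_le_iff; (intro ballI)?)
      fix u assume "u \<in> (\<lambda>A. \<Sum>i\<in>A. rsign T i * (\<omega> (i, True) - \<omega> (i, False))) ` \<A>"
      then obtain A where A: "A \<in> \<A>" "u = (\<Sum>i\<in>A. rsign T i * (\<omega> (i, True) - \<omega> (i, False)))" by blast
      \<comment> \<open>On \<open>I\<close>, the negative of \<open>rsign T\<close> is
        \<open>rsign (I - T)\<close>, so the subtracted copy becomes a signed sum of the same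
        form.\<close>
      have "u = (\<Sum>i\<in>A. rsign T i * \<omega> (i, True)) + (\<Sum>i\<in>A. rsign (I - T) i * \<omega> (i, False))"
        unfolding A(2) sum.distrib[symmetric] using A mem
        by (intro sum.cong refl) (auto simp: rsign_def)
      also have "\<dots> \<le> Max ((\<lambda>A. \<Sum>i\<in>A. rsign T i * \<omega> (i, True)) ` \<A>)
        + Max ((\<lambda>A. \<Sum>i\<in>A. rsign (I - T) i * \<omega> (i, False)) ` \<A>)"
        using A fin by (intro add_mono Max_ge) auto
      finally show "u \<le> Max ((\<lambda>A. \<Sum>i\<in>A. rsign T i * \<omega> (i, True)) ` \<A>)
        + Max ((\<lambda>A. \<Sum>i\<in>A. rsign (I - T) i * \<omega> (i, False)) ` \<A>)" .
    qed (use fin \<A> in auto)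
    then have "integral\<^sup>L R (H T) \<le> (\<integral>\<omega>. Max ((\<lambda>A. \<Sum>i\<in>A. rsign T i * \<omega> (i, True)) ` \<A>)
        + Max ((\<lambda>A. \<Sum>i\<in>A. rsign (I - T) i * \<omega> (i, False)) ` \<A>) \<partial>R)"
      by (intro integral_mono H_int Bochner_Integration.integrable_add m_int)
    then show ?thesis by (simp add: Bochner_Integration.integral_add m_int m_eq)
  qed
  have "integral\<^sup>L R (H I) = rmean I (\<lambda>T. integral\<^sup>L R (H I))" using I by (simp add: rmean_const)
  also have "\<dots> \<le> rmean I (\<lambda>T. m T + m (I - T))"
  proof (rule rmean_mono)
    fix T assume "T \<subseteq> I"
    then show "integral\<^sup>L R (H I) \<le> m T + m (I - T)" using two three by simp
  qed
  also have "\<dots> = 2 * rmean I m" by (simp add: rmean_add rmean_complement)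
  finally show ?thesis using one unfolding m_def[abs_def] by simp
qed

section \<open>Expected maxima of sums of independent centred variables over a VC class\<close>

lemma borel_measurable_coordinate:
  "i \<in> I \<Longrightarrow> (\<lambda>v. v i) \<in> borel_measurable (Pi\<^sub>M I (\<lambda>_. borel))"
  by (rule measurable_component_singleton)

context prob_space
begin

text \<open>Independence identifies the joint law with the product of the marginals, where
  symmetrization applies. The mean over signs is a finite sum, so it exchanges with the integral and
  the bound for frozen noise is applied pointwise. Its coefficients 13 and \<open>5 / 2\<close> are
  doubled.\<close>

lemma expectation_Max_le:
  fixes t p :: real
  assumes I: "finite I" "I \<noteq> {}" and X: "indep_vars (\<lambda>_. borel) X I"
    "\<And>i. i \<in> I \<Longrightarrow> integrable M (X i)" "\<And>i. i \<in> I \<Longrightarrow> expectation (X i) = 0"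
    and \<A>: "\<A> \<subseteq> Pow I" "\<A> \<noteq> {}" and D: "1 \<le> D" and t: "0 < t" and p: "1 \<le> p" "p \<le> 2"
    and vc: "\<And>S. S \<subseteq> I \<Longrightarrow> shatters \<A> S \<Longrightarrow> card S \<le> D"
    and Xp: "\<And>i. i \<in> I \<Longrightarrow> integrable M (\<lambda>\<omega>. \<bar>X i \<omega>\<bar> powr p)"
  shows "expectation (\<lambda>\<omega>. Max ((\<lambda>A. \<Sum>i\<in>A. X i \<omega>) ` \<A>))
    \<le> 26 * (D * t) + 5 * (t powr (1 - p) * (\<Sum>i\<in>I. expectation (\<lambda>\<omega>. \<bar>X i \<omega>\<bar> powr p)))"
proof -
  have fin: "finite \<A>" using I \<A> by (meson finite_Pow_iff finite_subset)
  have mem: "i \<in> I" if "i \<in> A" "A \<in> \<A>" for i A using that \<A> by auto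
  have rv: "X i \<in> borel_measurable M" if "i \<in> I" for i using X(2) that by auto
  \<comment> \<open>\<open>symmetrization\<close> asks for a centred law at every index, so the
    family is extended by 0 outside \<open>I\<close>.\<close>
  define Z where "Z i = (if i \<in> I then X i else (\<lambda>_. 0))" for i
  have Z: "Z i \<in> borel_measurable M" "integrable M (Z i)" "expectation (Z i) = 0" for i
    using rv X by (simp_all add: Z_def)
  define N where "N i = distr M borel (Z i)" for i
  define P where "P = Pi\<^sub>M I N"
  have Np: "prob_space (N i)" for i
    unfolding N_def using Z by (intro prob_space_distr)
  have Ni: "integrable (N i) (\<lambda>x. x)" for i
    using Z[of i] by (simp add: N_def integrable_distr_eq)
  have N0: "(\<integral>x. x \<partial>N i) = 0" for i
    using Z[of i] by (simp add: N_def integral_distr)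
  have P: "P = distr M (Pi\<^sub>M I (\<lambda>_. borel)) (\<lambda>\<omega>. \<lambda>i\<in>I. X i \<omega>)"
  proof -
    have "distr M (Pi\<^sub>M I (\<lambda>_. borel)) (\<lambda>\<omega>. \<lambda>i\<in>I. X i \<omega>) = Pi\<^sub>M I (\<lambda>i. distr M borel (X i))"
      using indep_vars_iff_distr_eq_PiM'[where I = I and M' = "\<lambda>_. borel" and X = X] I rv X(1) by auto
    also have "\<dots> = P" unfolding P_def by (intro PiM_cong) (auto simp: N_def Z_def)
    finally show ?thesis ..
  qed
  have mr: "(\<lambda>\<omega>. \<lambda>i\<in>I. X i \<omega>) \<in> measurable M (Pi\<^sub>M I (\<lambda>_. borel))"
    using rv by (intro measurable_restrict) auto
  interpret P: prob_space P unfolding P_def by (intro prob_space_PiM Np)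
  have Pint: "integrable P g" if "g \<in> borel_measurable (Pi\<^sub>M I (\<lambda>_. borel))" "integrable M (\<lambda>\<omega>. g (\<lambda>i\<in>I. X i \<omega>))"
    for g :: "_ \<Rightarrow> real" unfolding P using that mr by (simp add: integrable_distr_eq)
  have Peq: "integral\<^sup>L P g = expectation (\<lambda>\<omega>. g (\<lambda>i\<in>I. X i \<omega>))"
    if "g \<in> borel_measurable (Pi\<^sub>M I (\<lambda>_. borel))" for g :: "_ \<Rightarrow> real"
    unfolding P using that mr by (simp add: integral_distr)
  have coord: "integrable P (\<lambda>v. v i)" if "i \<in> I" for i
    unfolding P_def using that Np Ni by (intro integrable_PiM_component) auto
  have sint: "integrable P (\<lambda>v. Max ((\<lambda>A. \<Sum>i\<in>A. rsign T i * v i) ` \<A>))" for T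
    using \<A> fin mem by (intro integrable_MAX Bochner_Integration.integrable_sum integrable_mult_right coord) auto
  have powr: "integrable P (\<lambda>v. \<bar>v i\<bar> powr p)" "(\<integral>v. \<bar>v i\<bar> powr p \<partial>P) = expectation (\<lambda>\<omega>. \<bar>X i \<omega>\<bar> powr p)"
    if "i \<in> I" for i
  proof -
    have "(\<lambda>v. \<bar>v i\<bar> powr p) \<in> borel_measurable (Pi\<^sub>M I (\<lambda>_. borel))"
      using borel_measurable_coordinate[OF that] by measurable
    note meas = this
    have restr: "\<bar>(\<lambda>j\<in>I. X j \<omega>) i\<bar> powr p = \<bar>X i \<omega>\<bar> powr p" for \<omega> using that by simp
    show "integrable P (\<lambda>v. \<bar>v i\<bar> powr p)" using Xp[OF that] by (intro Pint meas) (simp only: restr)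
    show "(\<integral>v. \<bar>v i\<bar> powr p \<partial>P) = expectation (\<lambda>\<omega>. \<bar>X i \<omega>\<bar> powr p)"
      unfolding Peq[OF meas] restr ..
  qed
  have "expectation (\<lambda>\<omega>. Max ((\<lambda>A. \<Sum>i\<in>A. X i \<omega>) ` \<A>)) = expectation (\<lambda>\<omega>. Max ((\<lambda>A. \<Sum>i\<in>A. (\<lambda>i\<in>I. X i \<omega>) i) ` \<A>))"
    using mem by (intro Bochner_Integration.integral_cong arg_cong[where f = Max] image_cong sum.cong) auto
  also have "\<dots> = (\<integral>v. Max ((\<lambda>A. \<Sum>i\<in>A. v i) ` \<A>) \<partial>P)"
    using fin mem by (intro Peq[symmetric] borel_measurable_Max borel_measurable_sum borel_measurable_coordinate) auto
  also have "\<dots> \<le> 2 * rmean I (\<lambda>T. \<integral>v. Max ((\<lambda>A. \<Sum>i\<in>A. rsign T i * v i) ` \<A>) \<partial>P)"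
    unfolding P_def by (rule symmetrization[OF I(1) \<A> Np Ni N0])
  also have "rmean I (\<lambda>T. \<integral>v. Max ((\<lambda>A. \<Sum>i\<in>A. rsign T i * v i) ` \<A>) \<partial>P)
      = (\<integral>v. rmean I (\<lambda>T. Max ((\<lambda>A. \<Sum>i\<in>A. rsign T i * v i) ` \<A>)) \<partial>P)"
    by (rule integral_rmean[symmetric, OF sint])
  also have "\<dots> \<le> (\<integral>v. 13 * (D * t) + 5 / 2 * (t powr (1 - p) * (\<Sum>i\<in>I. \<bar>v i\<bar> powr p)) \<partial>P)"
  proof (rule integral_mono)
    show "integrable P (\<lambda>v. 13 * (D * t) + 5 / 2 * (t powr (1 - p) * (\<Sum>i\<in>I. \<bar>v i\<bar> powr p)))"
      by (intro Bochner_Integration.integrable_add P.integrable_const integrable_mult_right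
        Bochner_Integration.integrable_sum powr)
  qed (use rmean_Max_class_powr_le[OF I(1) \<A> D t p vc] in \<open>auto intro!: integrable_rmean sint\<close>)
  also have "\<dots> = 13 * (D * t) + 5 / 2 * (t powr (1 - p) * (\<Sum>i\<in>I. expectation (\<lambda>\<omega>. \<bar>X i \<omega>\<bar> powr p)))"
    using powr P.prob_space by simp
  finally show ?thesis by simp
qed

lemma expectation_Max_le_powr:
  assumes I: "finite I" "I \<noteq> {}" and X: "indep_vars (\<lambda>_. borel) X I"
    "\<And>i. i \<in> I \<Longrightarrow> integrable M (X i)" "\<And>i. i \<in> I \<Longrightarrow> expectation (X i) = 0"
    and \<A>: "\<A> \<subseteq> Pow I" "\<A> \<noteq> {}" and D: "1 \<le> D" and p: "1 \<le> p" "p \<le> 2"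
    and vc: "\<And>S. S \<subseteq> I \<Longrightarrow> shatters \<A> S \<Longrightarrow> card S \<le> D"
    and Xp: "\<And>i. i \<in> I \<Longrightarrow> integrable M (\<lambda>\<omega>. \<bar>X i \<omega>\<bar> powr p)"
  shows "expectation (\<lambda>\<omega>. Max ((\<lambda>A. \<Sum>i\<in>A. X i \<omega>) ` \<A>))
    \<le> 31 * (real D powr (1 - 1 / p) * (\<Sum>i\<in>I. expectation (\<lambda>\<omega>. \<bar>X i \<omega>\<bar> powr p)) powr (1 / p))"
proof -
  define S where "S = (\<Sum>i\<in>I. expectation (\<lambda>\<omega>. \<bar>X i \<omega>\<bar> powr p))"
  have le: "expectation (\<lambda>\<omega>. Max ((\<lambda>A. \<Sum>i\<in>A. X i \<omega>) ` \<A>)) \<le> 26 * (D * t) + 5 * (t powr (1 - p) * S)" if "0 < t" for t :: real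
    unfolding S_def by (rule expectation_Max_le[OF I X \<A> D that p vc Xp])
  have "0 \<le> S" unfolding S_def by (intro sum_nonneg integral_nonneg_AE) auto
  have D': "0 < real D" using D by simp
  show ?thesis
  proof (cases "S = 0")
    case True
    \<comment> \<open>The balancing level would be \<open>t = 0\<close>, which is not admissible;
      instead \<open>t\<close> tends to 0, chosen so that \<open>26 * (D * t)\<close> equals
      \<open>e\<close>.\<close>
    have "expectation (\<lambda>\<omega>. Max ((\<lambda>A. \<Sum>i\<in>A. X i \<omega>) ` \<A>)) \<le> 0"
    proof (rule field_le_epsilon)
      fix e :: real assume "0 < e"
      then show "expectation (\<lambda>\<omega>. Max ((\<lambda>A. \<Sum>i\<in>A. X i \<omega>) ` \<A>)) \<le> 0 + e"
        using le[of "e / (26 * real D)"] D' True by simp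
    qed
    then show ?thesis using True by (simp add: S_def)
  next
    case False
    then have S: "0 < S" using \<open>0 \<le> S\<close> by simp
    \<comment> \<open>This level equates \<open>D * t\<close> with
      \<open>t powr (1 - p) * S\<close>; both become
      \<open>D powr (1 - 1 / p) * S powr (1 / p)\<close>, whence \<open>31 = 26 + 5\<close>.\<close>
    define t where "t = (S / D) powr (1 / p)"
    have t: "0 < t" using S D' by (simp add: t_def)
    have "D * t = real D powr 1 * (S powr (1 / p) / real D powr (1 / p))"
      using S D' by (simp add: t_def powr_divide)
    also have "\<dots> = real D powr (1 - 1 / p) * S powr (1 / p)" by (simp add: powr_diff)
    finally have 1: "D * t = real D powr (1 - 1 / p) * S powr (1 / p)" .
    have "t powr (1 - p) * S = (S / D) powr (1 / p - 1) * S"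
      using p by (simp add: t_def powr_powr field_simps)
    also have "\<dots> = (S powr (1 / p - 1) * S powr 1) / real D powr (1 / p - 1)"
      using S D' by (simp add: powr_divide)
    also have "\<dots> = S powr (1 / p) / real D powr (1 / p - 1)" by (simp only: powr_add[symmetric]) simp
    also have "\<dots> = real D powr (1 - 1 / p) * S powr (1 / p)"
      using powr_minus_divide[of "real D" "1 / p - 1"] by simp
    finally show ?thesis using le[OF t] 1 by (simp add: S_def)
  qed
qed

end

section \<open>The risk bounds\<close>

text \<open>Repeated design points are handled here. Indices with the same point cannot be separated
  by a class pulled back along \<open>x\<close>, so \<open>x\<close> is injective on a shattered set
  of indices, and the class of sets of points realizes all subsets of its image.\<close>

lemma card_le_of_vc_dim_le:
  assumes vc: "vc_dim_le (x ` I) \<C> D" and S: "S \<subseteq> I" "finite S"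
    and sh: "shatters ((\<lambda>C. {i\<in>I. x i \<in> C}) ` \<C>) S"
  shows "card S \<le> D"
proof (rule ccontr)
  assume "\<not> card S \<le> D"
  have ex: "\<exists>C\<in>\<C>. {i\<in>I. x i \<in> C} \<inter> S = E" if "E \<subseteq> S" for E
    using sh that unfolding shatters_def by blast
  have inj: "inj_on x S"
  proof (rule inj_onI, rule ccontr)
    fix i j assume ij: "i \<in> S" "j \<in> S" "x i = x j" "i \<noteq> j"
    then obtain C where C: "{k\<in>I. x k \<in> C} \<inter> S = {i}" using ex[of "{i}"] by blast
    then have "x i \<in> C" by blast
    then have "j \<in> {k\<in>I. x k \<in> C} \<inter> S" using ij S by auto
    then show False using C \<open>i \<noteq> j\<close> by simp
  qed
  have "Pow (x ` S) \<subseteq> (\<lambda>A. x ` S \<inter> A) ` \<C>"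
  proof
    fix E assume "E \<in> Pow (x ` S)"
    moreover obtain C where "C \<in> \<C>" "{k\<in>I. x k \<in> C} \<inter> S = {i\<in>S. x i \<in> E}"
      using ex[of "{i\<in>S. x i \<in> E}"] by blast
    ultimately have "E = x ` S \<inter> C" using S by blast
    then show "E \<in> (\<lambda>A. x ` S \<inter> A) ` \<C>" using \<open>C \<in> \<C>\<close> by blast
  qed
  moreover have "finite ((\<lambda>A. x ` S \<inter> A) ` \<C>)"
    by (rule finite_subset[of _ "Pow (x ` S)"]) (use S in auto)
  ultimately have "card (Pow (x ` S)) \<le> card ((\<lambda>A. x ` S \<inter> A) ` \<C>)" by (rule card_mono[rotated])
  moreover have "card (x ` S) = card S" using inj by (rule card_image)
  moreover have "card ((\<lambda>A. x ` S \<inter> A) ` \<C>) < 2 ^ card (x ` S)"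
    using S \<open>\<not> card S \<le> D\<close> \<open>card (x ` S) = card S\<close>
    by (intro vc[unfolded vc_dim_le_def, rule_format]) auto
  ultimately show False using S by (simp add: card_Pow)
qed

lemma extremal_elements_card_le:
  assumes "fbar \<in> extremal_elements x n F D" and S: "S \<subseteq> {1..n}"
  shows "shatters ((\<lambda>g. {i\<in>{1..n}. g (x i) < fbar (x i)}) ` F) S \<Longrightarrow> card S \<le> D"
    and "shatters ((\<lambda>g. {i\<in>{1..n}. g (x i) > fbar (x i)}) ` F) S \<Longrightarrow> card S \<le> D"
proof -
  let ?X = "x ` {1..n}" and ?I = "{1..n}"
  let ?G = "(\<lambda>f. restrict f ?X) ` F" and ?f = "restrict fbar ?X"
  have fin: "finite S" using S finite_subset by blast
  have vc: "vc_dim_le ?X ((\<lambda>g. {s\<in>?X. g s > ?f s}) ` ?G) D" "vc_dim_le ?X ((\<lambda>g. {s\<in>?X. g s < ?f s}) ` ?G) D"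
    using assms by (auto simp: extremal_elements_def extremal_def)
  have "(\<lambda>g. {i\<in>?I. g (x i) < fbar (x i)}) ` F = (\<lambda>C. {i\<in>?I. x i \<in> C}) ` (\<lambda>g. {s\<in>?X. g s < ?f s}) ` ?G"
    unfolding image_image by (intro image_cong) auto
  then show "card S \<le> D" if "shatters ((\<lambda>g. {i\<in>?I. g (x i) < fbar (x i)}) ` F) S"
    using card_le_of_vc_dim_le[OF vc(2) S fin] that by simp
  have "(\<lambda>g. {i\<in>?I. g (x i) > fbar (x i)}) ` F = (\<lambda>C. {i\<in>?I. x i \<in> C}) ` (\<lambda>g. {s\<in>?X. g s > ?f s}) ` ?G"
    unfolding image_image by (intro image_cong) auto
  then show "card S \<le> D" if "shatters ((\<lambda>g. {i\<in>?I. g (x i) > fbar (x i)}) ` F) S"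
    using card_le_of_vc_dim_le[OF vc(1) S fin] that by simp
qed

section \<open>Deterministic control of the loss by the test statistic\<close>

lemma test_pair_le: "test_pair x n y f g \<le> (\<Sum>i\<in>{1..n}. \<bar>f (x i) - y i\<bar>)"
  unfolding test_pair_def by (intro sum_mono) (auto simp: sgn_if)

lemma test_pair_le_test_sup: "g \<in> F \<Longrightarrow> test_pair x n y f g \<le> test_sup x n y F f"
  unfolding test_sup_def by (intro cSUP_upper bdd_aboveI2[OF test_pair_le])

text \<open>Near minimality bounds the test of \<open>fh\<close> against \<open>fbar\<close> by
  \<open>test_sup x n y F fbar + c\<close>, and the reverse test is one of those under the supremum
  for \<open>fbar\<close>: hence the factor 2 and a single \<open>c\<close>.\<close>

lemma estimator_set_dist_le:
  assumes "fh \<in> estimator_set x n y F c" "fbar \<in> F"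
  shows "(\<Sum>i\<in>{1..n}. \<bar>fh (x i) - fbar (x i)\<bar>) \<le> 2 * test_sup x n y F fbar + c"
proof -
  have fh: "fh \<in> F" "test_sup x n y F fh \<le> (INF g\<in>F. test_sup x n y F g) + c"
    using assms by (auto simp: estimator_set_def)
  have "0 \<le> test_sup x n y F g" if "g \<in> F" for g
    using test_pair_le_test_sup[OF that, of x n y g] by (simp add: test_pair_def)
  then have "(INF g\<in>F. test_sup x n y F g) \<le> test_sup x n y F fbar"
    using assms(2) by (intro cINF_lower bdd_belowI2)
  moreover have "(\<Sum>i\<in>{1..n}. \<bar>fh (x i) - fbar (x i)\<bar>) = test_pair x n y fh fbar + test_pair x n y fbar fh"
    unfolding test_pair_def sum.distrib[symmetric] by (intro sum.cong) (auto simp: sgn_if)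
  moreover have "test_pair x n y fh fbar \<le> test_sup x n y F fh" "test_pair x n y fbar fh \<le> test_sup x n y F fbar"
    using test_pair_le_test_sup assms(2) fh(1) by blast+
  ultimately show ?thesis using fh(2) by linarith
qed

text \<open>At each index, \<open>fbar - y = (fbar - fstar) + (fstar - y)\<close>. Whatever the sign
  of \<open>fbar - g\<close>, the first part costs at most its absolute value; the second is kept
  where \<open>g < fbar\<close> and reversed where \<open>g > fbar\<close>.\<close>

lemma test_sup_le:
  assumes "F \<noteq> {}"
  shows "test_sup x n y F fbar \<le> (\<Sum>i\<in>{1..n}. \<bar>fstar (x i) - fbar (x i)\<bar>)
    + Max ((\<lambda>A. \<Sum>i\<in>A. fstar (x i) - y i) ` ((\<lambda>g. {i\<in>{1..n}. g (x i) < fbar (x i)}) ` F))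
    + Max ((\<lambda>A. \<Sum>i\<in>A. y i - fstar (x i)) ` ((\<lambda>g. {i\<in>{1..n}. g (x i) > fbar (x i)}) ` F))"
    (is "_ \<le> ?d + Max (?X ` ?\<A>) + Max (?Y ` ?\<B>)")
  unfolding test_sup_def
proof (rule cSUP_least[OF assms])
  fix g assume g: "g \<in> F"
  let ?A = "{i\<in>{1..n}. g (x i) < fbar (x i)}" and ?B = "{i\<in>{1..n}. g (x i) > fbar (x i)}"
  have fin: "finite ?\<A>" "finite ?\<B>" by (auto intro!: finite_subset[of _ "Pow {1..n}"])
  have "test_pair x n y fbar g \<le> (\<Sum>i\<in>{1..n}. \<bar>fstar (x i) - fbar (x i)\<bar>
      + (if g (x i) < fbar (x i) then fstar (x i) - y i else 0)
      + (if g (x i) > fbar (x i) then y i - fstar (x i) else 0))"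
    unfolding test_pair_def by (intro sum_mono) (auto simp: sgn_if abs_if)
  also have "\<dots> = ?d + ?X ?A + ?Y ?B"
    by (simp only: sum.distrib sum.inter_filter[OF finite_atLeastAtMost])
  also have "\<dots> \<le> ?d + Max (?X ` ?\<A>) + Max (?Y ` ?\<B>)"
    using g fin by (intro add_mono order_refl Max_ge) auto
  finally show "test_pair x n y fbar g \<le> ?d + Max (?X ` ?\<A>) + Max (?Y ` ?\<B>)" .
qed

text \<open>Since \<open>b\<close> and \<open>k\<close> are finite and \<open>k\<close> is positive,
  both can be moved to the left side, leaving a lower bound of the family. It is used for the infima
  over \<open>p\<close>, over \<open>fbar\<close> and over \<open>D\<close>; for an empty family the
  right side is infinite.\<close>

lemma ennreal_le_add_mult_INF:
  fixes b y :: ennreal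
  assumes "0 < k" "b \<noteq> top" and le: "\<And>p. p \<in> P \<Longrightarrow> y \<le> b + ennreal k * f p"
  shows "y \<le> b + ennreal k * (INF p\<in>P. f p)"
proof -
  have k: "ennreal (1 / k) * (ennreal k * z) = z" "ennreal k * (ennreal (1 / k) * z) = z" for z
    using assms(1) by (simp_all add: mult.assoc[symmetric] ennreal_mult[symmetric])
  have "ennreal (1 / k) * (y - b) \<le> (INF p\<in>P. f p)"
  proof (rule INF_greatest)
    fix p assume "p \<in> P"
    then have "y - b \<le> ennreal k * f p" using le assms(2) by (simp add: ennreal_minus_le_iff)
    then have "ennreal (1 / k) * (y - b) \<le> ennreal (1 / k) * (ennreal k * f p)" by (intro mult_left_mono) auto
    then show "ennreal (1 / k) * (y - b) \<le> f p" by (simp only: k)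
  qed
  then have "ennreal k * (ennreal (1 / k) * (y - b)) \<le> ennreal k * (INF p\<in>P. f p)" by (intro mult_left_mono) auto
  then show ?thesis by (simp only: k) (simp add: ennreal_minus_le_iff)
qed

section \<open>Measurability of the loss and finiteness of the moments\<close>

lemma measurable_responses:
  assumes "regression_setting M n x Y fstar F c fhat"
  shows "responses n Y \<in> measurable M (Pi\<^sub>M {1..n} (\<lambda>_. borel))"
  unfolding responses_def using assms
  by (intro measurable_restrict) (auto simp: regression_setting_def)

lemma measurable_fhat:
  assumes "regression_setting M n x Y fstar F c fhat" "i \<in> {1..n}"
  shows "(\<lambda>\<omega>. fhat (responses n Y \<omega>) (x i)) \<in> borel_measurable M"
  using measurable_compose[OF measurable_responses[OF assms(1)], of "\<lambda>y. fhat y (x i)" borel] assms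
  by (auto simp: regression_setting_def)

lemma measurable_loss_fhat:
  assumes "regression_setting M n x Y fstar F c fhat"
  shows "(\<lambda>\<omega>. loss x n (fhat (responses n Y \<omega>)) g) \<in> borel_measurable M"
  unfolding loss_def using measurable_fhat[OF assms]
  by (intro borel_measurable_times borel_measurable_const borel_measurable_sum borel_measurable_abs
    borel_measurable_diff)

lemma loss_nonneg: "0 \<le> loss x n f g"
  by (auto simp: loss_def intro!: sum_nonneg)

lemma sigma_p_eq:
  assumes "0 < n" "0 < p" and \<xi>: "\<And>i. i \<in> {1..n} \<Longrightarrow> integrable M (\<lambda>\<omega>. \<bar>Y i \<omega> - integral\<^sup>L M (Y i)\<bar> powr p)"
  shows "sigma_p M n Y p =
    ennreal (((\<Sum>i\<in>{1..n}. \<integral>\<omega>. \<bar>Y i \<omega> - integral\<^sup>L M (Y i)\<bar> powr p \<partial>M) / n) powr (1 / p))"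
proof -
  let ?e = "\<lambda>i. \<integral>\<omega>. \<bar>Y i \<omega> - integral\<^sup>L M (Y i)\<bar> powr p \<partial>M"
  have "(\<Sum>i\<in>{1..n}. \<integral>\<^sup>+\<omega>. ennreal (\<bar>Y i \<omega> - integral\<^sup>L M (Y i)\<bar> powr p) \<partial>M) = (\<Sum>i\<in>{1..n}. ennreal (?e i))"
    using \<xi> by (intro sum.cong refl nn_integral_eq_integral) auto
  also have "\<dots> = ennreal (\<Sum>i\<in>{1..n}. ?e i)" by (intro sum_ennreal) simp
  finally have "ennreal (1 / n) * (\<Sum>i\<in>{1..n}. \<integral>\<^sup>+\<omega>. ennreal (\<bar>Y i \<omega> - integral\<^sup>L M (Y i)\<bar> powr p) \<partial>M)
      = ennreal ((\<Sum>i\<in>{1..n}. ?e i) / n)"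
    by (simp add: ennreal_mult[symmetric] sum_nonneg)
  then show ?thesis by (simp add: sigma_p_def ennreal_root_def sum_nonneg)
qed

lemma integrable_of_sigma_p_finite:
  assumes "0 < n" "sigma_p M n Y p \<noteq> \<infinity>" "i \<in> {1..n}" "Y i \<in> borel_measurable M"
  shows "integrable M (\<lambda>\<omega>. \<bar>Y i \<omega> - integral\<^sup>L M (Y i)\<bar> powr p)"
proof -
  let ?J = "\<lambda>i. \<integral>\<^sup>+\<omega>. ennreal (\<bar>Y i \<omega> - integral\<^sup>L M (Y i)\<bar> powr p) \<partial>M"
  have "ennreal (1 / n) * (\<Sum>i\<in>{1..n}. ?J i) \<noteq> \<infinity>"
    using assms(2) by (auto simp: sigma_p_def ennreal_root_def)
  then have "(\<Sum>i\<in>{1..n}. ?J i) \<noteq> \<infinity>" using assms(1) by (auto simp: ennreal_mult_eq_top_iff)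
  then have "?J i < \<infinity>" using assms(3) by (auto simp: top.not_eq_extremum)
  moreover have "(\<lambda>\<omega>. \<bar>Y i \<omega> - integral\<^sup>L M (Y i)\<bar> powr p) \<in> borel_measurable M"
    using assms(4) by measurable
  ultimately show ?thesis by (intro integrableI_nonneg) simp_all
qed

lemma loss_bound_at_exponent:
  assumes rs: "regression_setting M n x Y fstar F c fhat" and D: "D \<in> {1..n}"
    and fbar: "fbar \<in> extremal_elements x n F D" and p: "1 \<le> p" "p \<le> 2"
  shows "(\<integral>\<^sup>+\<omega>. ennreal (loss x n (fhat (responses n Y \<omega>)) fbar) \<partial>M)
    \<le> 2 * ennreal (loss x n fstar fbar)
      + ennreal 124 * (sigma_p M n Y p * ennreal ((real D / real n) powr (1 - 1 / p))) + ennreal (c / real n)"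
proof (cases "sigma_p M n Y p = \<infinity>")
  case True
  \<comment> \<open>In \<open>ennreal\<close>, \<open>0 * top = 0\<close>, so the strict positivity
    of the weight, due to \<open>D \<ge> 1\<close>, matters.\<close>
  have "0 < (real D / real n) powr (1 - 1 / p)" using D by simp
  then have "sigma_p M n Y p * ennreal ((real D / real n) powr (1 - 1 / p)) = top"
    using True by (simp add: ennreal_top_mult)
  then have "ennreal 124 * (sigma_p M n Y p * ennreal ((real D / real n) powr (1 - 1 / p))) = top"
    by (simp add: ennreal_mult_top)
  then show ?thesis by simp
next
  case False
  interpret prob_space M using rs by (simp add: regression_setting_def)
  let ?I = "{1..n}"
  have n: "0 < n" using rs by (simp add: regression_setting_def)
  have Y: "\<And>i. i \<in> ?I \<Longrightarrow> integrable M (Y i)" "\<And>i. i \<in> ?I \<Longrightarrow> fstar (x i) = expectation (Y i)"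
    "indep_vars (\<lambda>_. borel) Y ?I" "F \<noteq> {}" "0 \<le> c"
    using rs by (auto simp: regression_setting_def)
  have fbarF: "fbar \<in> F" using fbar by (simp add: extremal_elements_def)
  define \<xi> where "\<xi> i \<omega> = fstar (x i) - Y i \<omega>" for i \<omega>
  define \<eta> where "\<eta> i \<omega> = Y i \<omega> - fstar (x i)" for i \<omega>
  define \<A> where "\<A> = (\<lambda>g. {i\<in>?I. g (x i) < fbar (x i)}) ` F"
  define \<B> where "\<B> = (\<lambda>g. {i\<in>?I. g (x i) > fbar (x i)}) ` F"
  define U where "U \<omega> = Max ((\<lambda>A. \<Sum>i\<in>A. \<xi> i \<omega>) ` \<A>)" for \<omega>
  define V where "V \<omega> = Max ((\<lambda>A. \<Sum>i\<in>A. \<eta> i \<omega>) ` \<B>)" for \<omega>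
  have \<A>: "\<A> \<subseteq> Pow ?I" "\<A> \<noteq> {}" and \<B>: "\<B> \<subseteq> Pow ?I" "\<B> \<noteq> {}"
    using Y(4) by (auto simp: \<A>_def \<B>_def)
  have fin: "finite \<A>" "finite \<B>" using \<A> \<B> by (meson finite_Pow_iff finite_atLeastAtMost finite_subset)+
  have mem: "i \<in> A \<Longrightarrow> A \<in> \<A> \<Longrightarrow> i \<in> ?I" "i \<in> A \<Longrightarrow> A \<in> \<B> \<Longrightarrow> i \<in> ?I" for i A
    using \<A> \<B> by blast+
  have vc: "\<And>S. S \<subseteq> ?I \<Longrightarrow> shatters \<A> S \<Longrightarrow> card S \<le> D" "\<And>S. S \<subseteq> ?I \<Longrightarrow> shatters \<B> S \<Longrightarrow> card S \<le> D"
    using extremal_elements_card_le[OF fbar] unfolding \<A>_def \<B>_def by blast+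
  define S where "S = (\<Sum>i\<in>?I. expectation (\<lambda>\<omega>. \<bar>Y i \<omega> - expectation (Y i)\<bar> powr p))"
  define b where "b = 31 * (real D powr (1 - 1 / p) * S powr (1 / p))"
  have powr_int: "integrable M (\<lambda>\<omega>. \<bar>Y i \<omega> - expectation (Y i)\<bar> powr p)" if "i \<in> ?I" for i
    using integrable_of_sigma_p_finite[OF n False that] Y(1)[OF that] by auto
  have abs: "\<bar>\<xi> i \<omega>\<bar> = \<bar>Y i \<omega> - expectation (Y i)\<bar>" "\<bar>\<eta> i \<omega>\<bar> = \<bar>Y i \<omega> - expectation (Y i)\<bar>" if "i \<in> ?I" for i \<omega>
    using Y(2)[OF that] by (auto simp: \<xi>_def \<eta>_def)
  have S: "S = (\<Sum>i\<in>?I. expectation (\<lambda>\<omega>. \<bar>\<xi> i \<omega>\<bar> powr p))" "S = (\<Sum>i\<in>?I. expectation (\<lambda>\<omega>. \<bar>\<eta> i \<omega>\<bar> powr p))"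
    unfolding S_def by (simp_all add: abs)
  have \<xi>: "indep_vars (\<lambda>_. borel) \<xi> ?I" "\<And>i. i \<in> ?I \<Longrightarrow> integrable M (\<xi> i)" "\<And>i. i \<in> ?I \<Longrightarrow> expectation (\<xi> i) = 0"
    and \<eta>: "indep_vars (\<lambda>_. borel) \<eta> ?I" "\<And>i. i \<in> ?I \<Longrightarrow> integrable M (\<eta> i)" "\<And>i. i \<in> ?I \<Longrightarrow> expectation (\<eta> i) = 0"
  proof -
    show "indep_vars (\<lambda>_. borel) \<xi> ?I" "indep_vars (\<lambda>_. borel) \<eta> ?I"
      unfolding \<xi>_def[abs_def] \<eta>_def[abs_def]
      using indep_vars_compose2[OF Y(3), of "\<lambda>i y. fstar (x i) - y" "\<lambda>_. borel"]
        indep_vars_compose2[OF Y(3), of "\<lambda>i y. y - fstar (x i)" "\<lambda>_. borel"] by simp_all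
  qed (use Y(1,2) prob_space in \<open>simp_all add: \<xi>_def[abs_def] \<eta>_def[abs_def]\<close>)
  have D1: "1 \<le> D" and I: "finite ?I" "?I \<noteq> {}" using D by auto
  have EU: "expectation U \<le> b"
    unfolding U_def[abs_def] b_def S(1)
    by (rule expectation_Max_le_powr[OF I \<xi> \<A> D1 p vc(1)]) (auto simp: abs powr_int)
  have EV: "expectation V \<le> b"
    unfolding V_def[abs_def] b_def S(2)
    by (rule expectation_Max_le_powr[OF I \<eta> \<B> D1 p vc(2)]) (auto simp: abs powr_int)
  have Uint: "integrable M U" and Vint: "integrable M V"
    unfolding U_def[abs_def] V_def[abs_def] using \<A> \<B>
    by (intro integrable_MAX fin Bochner_Integration.integrable_sum \<xi> \<eta>; blast)+
  let ?l = "loss x n fstar fbar"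
  \<comment> \<open>An integrable majorant that turns the \<open>nn_integral\<close> into an
    expectation; it is nonnegative because it dominates a loss.\<close>
  define H where "H \<omega> = 2 * ?l + (2 / n) * (U \<omega> + V \<omega>) + c / n" for \<omega>
  have loss_le: "loss x n (fhat (responses n Y \<omega>)) fbar \<le> H \<omega>" if \<omega>: "\<omega> \<in> space M" for \<omega>
  proof -
    let ?y = "responses n Y \<omega>"
    have "fhat ?y \<in> estimator_set x n ?y F c" using rs \<omega> by (simp add: regression_setting_def)
    note estimator_set_dist_le[OF this fbarF]
    moreover have "test_sup x n ?y F fbar \<le> (\<Sum>i\<in>?I. \<bar>fstar (x i) - fbar (x i)\<bar>)
      + Max ((\<lambda>A. \<Sum>i\<in>A. fstar (x i) - ?y i) ` \<A>) + Max ((\<lambda>A. \<Sum>i\<in>A. ?y i - fstar (x i)) ` \<B>)"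
      unfolding \<A>_def \<B>_def by (rule test_sup_le[OF Y(4)])
    moreover have y: "?y i = Y i \<omega>" if "i \<in> ?I" for i using that by (simp add: responses_def)
    have "(\<lambda>A. \<Sum>i\<in>A. fstar (x i) - ?y i) ` \<A> = (\<lambda>A. \<Sum>i\<in>A. \<xi> i \<omega>) ` \<A>"
      unfolding \<xi>_def by (intro image_cong sum.cong refl arg_cong2[where f = "(-)"] y mem(1))
    moreover have "(\<lambda>A. \<Sum>i\<in>A. ?y i - fstar (x i)) ` \<B> = (\<lambda>A. \<Sum>i\<in>A. \<eta> i \<omega>) ` \<B>"
      unfolding \<eta>_def by (intro image_cong sum.cong refl arg_cong2[where f = "(-)"] y mem(2))
    ultimately have "(\<Sum>i\<in>?I. \<bar>fhat ?y (x i) - fbar (x i)\<bar>)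
        \<le> 2 * ((\<Sum>i\<in>?I. \<bar>fstar (x i) - fbar (x i)\<bar>) + U \<omega> + V \<omega>) + c"
      by (simp add: U_def V_def)
    then have "(\<Sum>i\<in>?I. \<bar>fhat ?y (x i) - fbar (x i)\<bar>) / n
        \<le> (2 * ((\<Sum>i\<in>?I. \<bar>fstar (x i) - fbar (x i)\<bar>) + U \<omega> + V \<omega>) + c) / n"
      by (intro divide_right_mono) auto
    then show ?thesis by (simp add: loss_def H_def add_divide_distrib distrib_left)
  qed
  have Hint: "integrable M H" unfolding H_def[abs_def]
    by (intro Bochner_Integration.integrable_add integrable_const integrable_mult_right Uint Vint)
  have "(\<integral>\<^sup>+\<omega>. ennreal (loss x n (fhat (responses n Y \<omega>)) fbar) \<partial>M) \<le> (\<integral>\<^sup>+\<omega>. ennreal (H \<omega>) \<partial>M)"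
    using loss_le by (intro nn_integral_mono ennreal_leI)
  also have "\<dots> = ennreal (expectation H)"
    using loss_le loss_nonneg order_trans by (intro nn_integral_eq_integral Hint AE_I2) blast
  also have "expectation H = 2 * ?l + (2 / n) * (expectation U + expectation V) + c / n"
    unfolding H_def[abs_def] using Uint Vint prob_space by simp
  also have "\<dots> \<le> 2 * ?l + (2 / n) * (b + b) + c / n"
    using EU EV by (intro add_mono mult_left_mono) auto
  also have "(2 / n) * (b + b) = 124 * ((S / n) powr (1 / p) * (real D / real n) powr (1 - 1 / p))"
  proof -
    have "0 \<le> S" unfolding S_def by (intro sum_nonneg) simp
    \<comment> \<open>The factor \<open>1 / n\<close> is shared between the moment and the
      dimension, which produces \<open>S / n\<close> and \<open>D / n\<close>; the number is
      \<open>2 * (31 + 31) = 124\<close>.\<close>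
    have "real n = real n powr (1 / p) * real n powr (1 - 1 / p)" using n by (simp add: powr_add[symmetric])
    then have "S powr (1 / p) * real D powr (1 - 1 / p) / n = (S / n) powr (1 / p) * (real D / real n) powr (1 - 1 / p)"
      using \<open>0 \<le> S\<close> n by (simp add: powr_divide)
    then show ?thesis by (simp add: b_def mult.commute)
  qed
  finally have "(\<integral>\<^sup>+\<omega>. ennreal (loss x n (fhat (responses n Y \<omega>)) fbar) \<partial>M)
    \<le> ennreal (2 * ?l + 124 * ((S / n) powr (1 / p) * (real D / real n) powr (1 - 1 / p)) + c / n)"
    by (simp add: ennreal_leI)
  also have "\<dots> = 2 * ennreal ?l + ennreal 124 * (ennreal ((S / n) powr (1 / p)) * ennreal ((real D / real n) powr (1 - 1 / p)))
      + ennreal (c / n)"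
    using loss_nonneg[of x n fstar fbar] Y(5) by (simp add: ennreal_mult)
  also have "ennreal ((S / n) powr (1 / p)) = sigma_p M n Y p"
    unfolding S_def using p n powr_int by (intro sigma_p_eq[symmetric]) auto
  finally show ?thesis .
qed

text \<open>The part of \<open>risk_bounds\<close> that implies the other two bounds with the same
  constant, so that only this part has to be carried between types.\<close>

definition first_risk_bound :: "'a itself \<Rightarrow> 'w itself \<Rightarrow> real \<Rightarrow> bool" where
  "first_risk_bound _ _ \<kappa> \<longleftrightarrow>
    (\<forall>(M :: 'w measure) n (x :: nat \<Rightarrow> 'a) Y fstar F c fhat.
      regression_setting M n x Y fstar F c fhat \<longrightarrow>
      (\<forall>D\<in>{1..n}. \<forall>fbar\<in>extremal_elements x n F D.
         (\<integral>\<^sup>+\<omega>. ennreal (loss x n (fhat (responses n Y \<omega>)) fbar) \<partial>M)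
           \<le> 2 * ennreal (loss x n fstar fbar) + ennreal \<kappa> * noise_term M n Y D
               + ennreal (c / real n)))"

lemma first_risk_bound_124: "first_risk_bound TYPE('a) TYPE('w) 124"
  unfolding first_risk_bound_def noise_term_def
proof (intro allI impI ballI)
  fix M :: "'w measure" and n and x :: "nat \<Rightarrow> 'a" and Y fstar F c fhat D fbar
  assume *: "regression_setting M n x Y fstar F c fhat" "D \<in> {1..n}" "fbar \<in> extremal_elements x n F D"
  have "(\<integral>\<^sup>+\<omega>. ennreal (loss x n (fhat (responses n Y \<omega>)) fbar) \<partial>M)
    \<le> (2 * ennreal (loss x n fstar fbar) + ennreal (c / real n))
      + ennreal 124 * (INF p\<in>{1..2}. sigma_p M n Y p * ennreal ((real D / real n) powr (1 - 1 / p)))"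
  proof (rule ennreal_le_add_mult_INF)
    fix p :: real assume "p \<in> {1..2}"
    then show "(\<integral>\<^sup>+\<omega>. ennreal (loss x n (fhat (responses n Y \<omega>)) fbar) \<partial>M)
      \<le> (2 * ennreal (loss x n fstar fbar) + ennreal (c / real n))
        + ennreal 124 * (sigma_p M n Y p * ennreal ((real D / real n) powr (1 - 1 / p)))"
      using loss_bound_at_exponent[OF *, of p] by (simp add: ac_simps)
  qed (auto simp: ennreal_mult_eq_top_iff)
  then show "(\<integral>\<^sup>+\<omega>. ennreal (loss x n (fhat (responses n Y \<omega>)) fbar) \<partial>M)
    \<le> 2 * ennreal (loss x n fstar fbar)
      + ennreal 124 * (INF p\<in>{1..2}. sigma_p M n Y p * ennreal ((real D / real n) powr (1 - 1 / p)))
      + ennreal (c / real n)" by (simp add: ac_simps)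
qed

text \<open>The triangle inequality through \<open>fbar\<close> adds one approximation term to the
  two already present, hence the factor 3. The bound is then minimized over \<open>fbar\<close> and
  over \<open>D\<close>; a degree without extremal elements contributes an infinite term.\<close>

lemma second_risk_bound:
  assumes rs: "regression_setting M n x Y fstar F c fhat" and "0 < \<kappa>"
    and first: "\<And>D fbar. D \<in> {1..n} \<Longrightarrow> fbar \<in> extremal_elements x n F D \<Longrightarrow>
      (\<integral>\<^sup>+\<omega>. ennreal (loss x n (fhat (responses n Y \<omega>)) fbar) \<partial>M)
        \<le> 2 * ennreal (loss x n fstar fbar) + ennreal \<kappa> * noise_term M n Y D + ennreal (c / real n)"
  shows "(\<integral>\<^sup>+\<omega>. ennreal (loss x n fstar (fhat (responses n Y \<omega>))) \<partial>M)
    \<le> (INF D\<in>{1..n}. 3 * loss_set x n fstar (extremal_elements x n F D) + ennreal \<kappa> * noise_term M n Y D)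
      + ennreal (c / real n)" (is "?R \<le> (INF D\<in>_. ?g D) + ?c")
proof -
  interpret prob_space M using rs by (simp add: regression_setting_def)
  have bound: "?R \<le> ?c + ennreal 1 * ?g D" if D: "D \<in> {1..n}" for D
  proof (cases "ennreal \<kappa> * noise_term M n Y D = top")
    \<comment> \<open>Only a finite noise term can be subtracted when the infimum over
      \<open>fbar\<close> is formed; if it is infinite, so is the right side.\<close>
    case False
    let ?E = "extremal_elements x n F D"
    have "?R \<le> (ennreal \<kappa> * noise_term M n Y D + ?c) + ennreal 3 * (INF g\<in>?E. ennreal (loss x n fstar g))"
    proof (rule ennreal_le_add_mult_INF)
      fix fbar assume fbar: "fbar \<in> ?E"
      have "loss x n fstar f \<le> loss x n fstar fbar + loss x n f fbar" for f
        unfolding loss_def distrib_left[symmetric] sum.distrib[symmetric]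
        by (intro mult_left_mono sum_mono) auto
      then have "?R \<le> (\<integral>\<^sup>+\<omega>. ennreal (loss x n fstar fbar) + ennreal (loss x n (fhat (responses n Y \<omega>)) fbar) \<partial>M)"
        by (intro nn_integral_mono) (simp add: ennreal_plus[symmetric] loss_nonneg del: ennreal_plus)
      also have "\<dots> = ennreal (loss x n fstar fbar) + (\<integral>\<^sup>+\<omega>. ennreal (loss x n (fhat (responses n Y \<omega>)) fbar) \<partial>M)"
        using measurable_loss_fhat[OF rs] by (subst nn_integral_add) (auto simp: emeasure_space_1)
      also have "\<dots> \<le> ennreal (loss x n fstar fbar)
          + (2 * ennreal (loss x n fstar fbar) + ennreal \<kappa> * noise_term M n Y D + ?c)"
        using first[OF D fbar] by (intro add_left_mono)
      also have "\<dots> = (ennreal \<kappa> * noise_term M n Y D + ?c) + (1 + 2) * ennreal (loss x n fstar fbar)"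
        by (simp only: distrib_right mult_1 ac_simps)
      finally show "?R \<le> (ennreal \<kappa> * noise_term M n Y D + ?c) + ennreal 3 * ennreal (loss x n fstar fbar)"
        by simp
    qed (use False in auto)
    then show ?thesis by (simp add: loss_set_def ac_simps)
  qed simp
  have "?R \<le> ?c + ennreal 1 * (INF D\<in>{1..n}. ?g D)"
    by (rule ennreal_le_add_mult_INF) (use bound in auto)
  then show ?thesis by (simp add: add.commute)
qed

lemma noise_term_le_variance:
  assumes "prob_space M" "0 < n" and Y: "\<And>i. i \<in> {1..n} \<Longrightarrow> integrable M (Y i)"
    and Y2: "\<And>i. i \<in> {1..n} \<Longrightarrow> integrable M (\<lambda>\<omega>. (Y i \<omega>)\<^sup>2)"
  shows "noise_term M n Y D
    \<le> ennreal (sqrt ((1 / real n * (\<Sum>i\<in>{1..n}. prob_space.variance M (Y i))) * (real D / real n)))"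
proof -
  interpret prob_space M by fact
  have sq: "\<bar>Y i \<omega> - expectation (Y i)\<bar> powr 2 = (Y i \<omega> - expectation (Y i))\<^sup>2" for i \<omega>
    by (cases "Y i \<omega> - expectation (Y i) = 0") (simp_all add: powr_numeral)
  have "integrable M (\<lambda>\<omega>. \<bar>Y i \<omega> - expectation (Y i)\<bar> powr 2)" if "i \<in> {1..n}" for i
    unfolding sq power2_diff using Y[OF that] Y2[OF that] by simp
  then have "sigma_p M n Y 2 = ennreal (((\<Sum>i\<in>{1..n}. variance (Y i)) / n) powr (1 / 2))"
    using sigma_p_eq[of n 2 M Y] \<open>0 < n\<close> by (simp add: sq)
  moreover have "noise_term M n Y D \<le> sigma_p M n Y 2 * ennreal ((real D / real n) powr (1 - 1 / 2))"
    unfolding noise_term_def by (rule INF_lower) simp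
  moreover have "0 \<le> (\<Sum>i\<in>{1..n}. variance (Y i))" by (intro sum_nonneg) simp
  ultimately show ?thesis
    by (simp add: powr_half_sqrt ennreal_mult[symmetric] real_sqrt_mult[symmetric])
qed

lemma risk_bounds_iff_first_risk_bound:
  assumes "0 < \<kappa>"
  shows "risk_bounds TYPE('a) TYPE('w) \<kappa> \<longleftrightarrow> first_risk_bound TYPE('a) TYPE('w) \<kappa>"
proof
  assume rb: "risk_bounds TYPE('a) TYPE('w) \<kappa>"
  show "first_risk_bound TYPE('a) TYPE('w) \<kappa>"
    unfolding first_risk_bound_def
    by (intro allI impI) (rule rb[unfolded risk_bounds_def, rule_format, THEN conjunct1])
next
  assume first: "first_risk_bound TYPE('a) TYPE('w) \<kappa>"
  show "risk_bounds TYPE('a) TYPE('w) \<kappa>"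
    unfolding risk_bounds_def
  proof (intro allI impI conjI)
    fix M :: "'w measure" and n and x :: "nat \<Rightarrow> 'a" and Y fstar F c fhat
    assume rs: "regression_setting M n x Y fstar F c fhat"
    show f: "\<forall>D\<in>{1..n}. \<forall>fbar\<in>extremal_elements x n F D.
      (\<integral>\<^sup>+\<omega>. ennreal (loss x n (fhat (responses n Y \<omega>)) fbar) \<partial>M)
        \<le> 2 * ennreal (loss x n fstar fbar) + ennreal \<kappa> * noise_term M n Y D + ennreal (c / real n)"
      by (intro ballI first[unfolded first_risk_bound_def, rule_format, OF rs])
    show second: "(\<integral>\<^sup>+\<omega>. ennreal (loss x n fstar (fhat (responses n Y \<omega>))) \<partial>M)
      \<le> (INF D\<in>{1..n}. 3 * loss_set x n fstar (extremal_elements x n F D) + ennreal \<kappa> * noise_term M n Y D)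
        + ennreal (c / real n)"
      using f by (intro second_risk_bound[OF rs assms]) blast
    assume Y2: "\<forall>i\<in>{1..n}. integrable M (\<lambda>\<omega>. (Y i \<omega>)\<^sup>2)"
    note second
    also have "(INF D\<in>{1..n}. 3 * loss_set x n fstar (extremal_elements x n F D) + ennreal \<kappa> * noise_term M n Y D)
        + ennreal (c / real n)
      \<le> (INF D\<in>{1..n}. 3 * loss_set x n fstar (extremal_elements x n F D)
        + ennreal (\<kappa> * sqrt ((1 / real n * (\<Sum>i\<in>{1..n}. prob_space.variance M (Y i))) * (real D / real n))))
        + ennreal (c / real n)"
    proof (intro add_right_mono INF_mono' add_left_mono)
      fix D
      have "ennreal \<kappa> * noise_term M n Y D
        \<le> ennreal \<kappa> * ennreal (sqrt ((1 / real n * (\<Sum>i\<in>{1..n}. prob_space.variance M (Y i))) * (real D / real n)))"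
        using rs Y2 by (intro mult_left_mono noise_term_le_variance) (auto simp: regression_setting_def)
      also have "\<dots> = ennreal (\<kappa> * sqrt ((1 / real n * (\<Sum>i\<in>{1..n}. prob_space.variance M (Y i))) * (real D / real n)))"
        using assms by (simp add: ennreal_mult')
      finally show "ennreal \<kappa> * noise_term M n Y D
        \<le> ennreal (\<kappa> * sqrt ((1 / real n * (\<Sum>i\<in>{1..n}. prob_space.variance M (Y i))) * (real D / real n)))" .
    qed
    finally show "(\<integral>\<^sup>+\<omega>. ennreal (loss x n fstar (fhat (responses n Y \<omega>))) \<partial>M)
      \<le> (INF D\<in>{1..n}. 3 * loss_set x n fstar (extremal_elements x n F D)
        + ennreal (\<kappa> * sqrt ((1 / real n * (\<Sum>i\<in>{1..n}. prob_space.variance M (Y i))) * (real D / real n))))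
        + ennreal (c / real n)" .
  qed
qed

section \<open>Independence of the constant from the types\<close>

text \<open>The members of \<open>\<C>\<close> lie in \<open>S\<close>, where \<open>h\<close> is
  injective, so images commute with intersections and the traces on \<open>B'\<close> are the images
  of the traces on \<open>B\<close>.\<close>

lemma vc_dim_le_image:
  assumes h: "inj_on h S" and \<C>: "\<C> \<subseteq> Pow S" and vc: "vc_dim_le S \<C> D"
  shows "vc_dim_le (h ` S) ((`) h ` \<C>) D"
  unfolding vc_dim_le_def
proof (intro allI impI)
  fix B' assume B': "B' \<subseteq> h ` S" "finite B'" "D < card B'"
  then obtain B where B: "B \<subseteq> S" "B' = h ` B" by (auto elim: subset_imageE)
  have inj: "inj_on h B" using h B(1) by (rule inj_on_subset)
  then have card: "card B' = card B" and finB: "finite B" using B B' by (auto simp: card_image finite_image_iff)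
  have "(\<lambda>A. B' \<inter> A) ` (`) h ` \<C> = (`) h ` (\<lambda>A. B \<inter> A) ` \<C>"
    unfolding image_image B(2) using \<C> B(1)
    by (intro image_cong refl inj_on_image_Int[OF h, symmetric]) auto
  moreover have "finite ((\<lambda>A. B \<inter> A) ` \<C>)"
    by (rule finite_subset[of _ "Pow B"]) (use finB in auto)
  ultimately have "card ((\<lambda>A. B' \<inter> A) ` (`) h ` \<C>) \<le> card ((\<lambda>A. B \<inter> A) ` \<C>)"
    by (simp add: card_image_le)
  also have "\<dots> < 2 ^ card B"
    using B B' card finB by (intro vc[unfolded vc_dim_le_def, rule_format]) auto
  finally show "card ((\<lambda>A. B' \<inter> A) ` (`) h ` \<C>) < 2 ^ card B'" using card by simp
qed

text \<open>Composition with the left inverse \<open>r\<close> moves functions to the new points, so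
  their comparison sets with \<open>fbar\<close> become the \<open>h\<close>-images of the old ones,
  and an injection does not raise the VC dimension.\<close>

lemma extremal_elements_transfer:
  fixes x :: "nat \<Rightarrow> 'a" and h :: "'a \<Rightarrow> 'b"
  assumes h: "inj_on h (x ` {1..n})" and r: "\<And>s. s \<in> x ` {1..n} \<Longrightarrow> r (h s) = s"
    and fbar: "fbar \<in> extremal_elements x n F D"
  shows "fbar \<circ> r \<in> extremal_elements (h \<circ> x) n ((\<lambda>f. f \<circ> r) ` F) D"
proof -
  let ?S = "x ` {1..n}"
  have S: "(h \<circ> x) ` {1..n} = h ` ?S" by (simp add: image_comp)
  \<comment> \<open>Stated for any comparison \<open>P\<close>, so that both orientations in the
    definition of \<open>extremal\<close> are covered at once.\<close>
  have *: "(\<lambda>g. {s\<in>h ` S. P (g s) (restrict (fbar \<circ> r) (h ` S) s)}) ` (\<lambda>f. restrict f (h ` S)) ` (\<lambda>f. f \<circ> r) ` F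
      = (`) h ` (\<lambda>g. {s\<in>S. P (g s) (restrict fbar S s)}) ` (\<lambda>f. restrict f S) ` F"
    if r: "\<And>s. s \<in> S \<Longrightarrow> r (h s) = s" for S and P :: "real \<Rightarrow> real \<Rightarrow> bool"
    unfolding image_image
  proof (rule image_cong[OF refl])
    fix g
    show "{s\<in>h ` S. P (restrict (g \<circ> r) (h ` S) s) (restrict (fbar \<circ> r) (h ` S) s)}
      = h ` {s\<in>S. P (restrict g S s) (restrict fbar S s)}"
    proof -
      have "{s\<in>h ` S. Q s} = h ` {s\<in>S. Q (h s)}" for Q by blast
      moreover have "{s\<in>S. P (restrict (g \<circ> r) (h ` S) (h s)) (restrict (fbar \<circ> r) (h ` S) (h s))}
          = {s\<in>S. P (restrict g S s) (restrict fbar S s)}"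
        by (intro Collect_cong conj_cong refl) (simp add: r)
      ultimately show ?thesis by simp
    qed
  qed
  have F: "fbar \<in> F"
    and vc: "vc_dim_le ?S ((\<lambda>g. {s\<in>?S. g s > restrict fbar ?S s}) ` (\<lambda>f. restrict f ?S) ` F) D"
      "vc_dim_le ?S ((\<lambda>g. {s\<in>?S. g s < restrict fbar ?S s}) ` (\<lambda>f. restrict f ?S) ` F) D"
    using fbar by (auto simp: extremal_elements_def extremal_def)
  have image: "vc_dim_le (h ` ?S) ((\<lambda>g. {s\<in>h ` ?S. P (g s) (restrict (fbar \<circ> r) (h ` ?S) s)}) `
      (\<lambda>f. restrict f (h ` ?S)) ` (\<lambda>f. f \<circ> r) ` F) D"
    if "vc_dim_le ?S ((\<lambda>g. {s\<in>?S. P (g s) (restrict fbar ?S s)}) ` (\<lambda>f. restrict f ?S) ` F) D"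
    for P :: "real \<Rightarrow> real \<Rightarrow> bool"
  proof -
    have "vc_dim_le (h ` ?S) ((`) h ` (\<lambda>g. {s\<in>?S. P (g s) (restrict fbar ?S s)}) ` (\<lambda>f. restrict f ?S) ` F) D"
      by (rule vc_dim_le_image[OF h _ that]) auto
    then show ?thesis by (simp only: *[of ?S P, OF r])
  qed
  show ?thesis
    unfolding extremal_elements_def extremal_def S
    using F image[of "\<lambda>u v. u > v", OF vc(1)] image[of "\<lambda>u v. u < v", OF vc(2)] by blast
qed

lemma estimator_set_transfer:
  assumes r: "\<And>i. i \<in> {1..n} \<Longrightarrow> r (h (x i)) = x i" and f: "f \<in> estimator_set x n y F c"
  shows "f \<circ> r \<in> estimator_set (h \<circ> x) n y ((\<lambda>f. f \<circ> r) ` F) c"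
proof -
  have "test_pair (h \<circ> x) n y (f \<circ> r) (g \<circ> r) = test_pair x n y f g" for f g
    unfolding test_pair_def using r by (intro sum.cong) auto
  then have "test_sup (h \<circ> x) n y ((\<lambda>f. f \<circ> r) ` F) (f \<circ> r) = test_sup x n y F f" for f
    by (simp add: test_sup_def image_image)
  then show ?thesis using f by (simp add: estimator_set_def image_image)
qed

text \<open>The law of the responses is placed on the set of their actual realisations, because the
  estimator is only known to be an almost minimiser there, not on all of the product space.\<close>

lemma first_risk_bound_transfer:
  assumes "first_risk_bound TYPE(nat) TYPE(nat \<Rightarrow> real) \<kappa>"
  shows "first_risk_bound TYPE('a) TYPE('w) \<kappa>"
  unfolding first_risk_bound_def
proof (intro allI impI ballI)
  fix M :: "'w measure" and n and x :: "nat \<Rightarrow> 'a" and Y fstar F c fhat D fbar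
  assume rs: "regression_setting M n x Y fstar F c fhat" and D: "D \<in> {1..n}"
    and fbar: "fbar \<in> extremal_elements x n F D"
  interpret prob_space M using rs by (simp add: regression_setting_def)
  let ?I = "{1..n}" and ?Y = "responses n Y"
  let ?P = "Pi\<^sub>M ?I (\<lambda>_. borel) :: (nat \<Rightarrow> real) measure"
  \<comment> \<open>Only the finitely many design points are embedded, so the size of the type
    \<open>'a\<close> is no obstacle.\<close>
  obtain h :: "'a \<Rightarrow> nat" where h: "inj_on h (x ` ?I)"
    using finite_imp_inj_to_nat_seg[of "x ` ?I"] by auto
  define r where "r = inv_into (x ` ?I) h"
  have r: "r (h (x i)) = x i" if "i \<in> ?I" for i
    unfolding r_def using h that by (intro inv_into_f_f) auto
  have I: "?I \<noteq> {}" using D by auto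
  have meas: "?Y \<in> measurable M ?P" by (rule measurable_responses[OF rs])
  define Q where "Q = restrict_space ?P (?Y ` space M)"
  have measQ: "?Y \<in> measurable M Q"
    unfolding Q_def using meas by (intro measurable_restrict_space2) auto
  define N where "N = distr M Q ?Y"
  define Y' where "Y' = (\<lambda>i (y :: nat \<Rightarrow> real). y i)"
  interpret N: prob_space N unfolding N_def by (rule prob_space_distr[OF measQ])
  have Y'_meas: "Y' i \<in> borel_measurable Q" if "i \<in> ?I" for i
    unfolding Y'_def Q_def by (intro measurable_restrict_space1 measurable_component_singleton that)
  have spaceN: "space N = ?Y ` space M"
    using measurable_space[OF meas] by (auto simp: N_def Q_def space_restrict_space)
  have resp: "responses n Y' (?Y \<omega>) = ?Y \<omega>" for \<omega> by (auto simp: responses_def Y'_def)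
  have Y'_Y: "Y' i (?Y \<omega>) = Y i \<omega>" if "i \<in> ?I" for i \<omega> using that by (simp add: Y'_def responses_def)
  have Yint: "integrable M (Y i)" "fstar (x i) = expectation (Y i)" if "i \<in> ?I" for i
    using rs that by (auto simp: regression_setting_def)
  have mean: "integral\<^sup>L N (Y' i) = expectation (Y i)" if "i \<in> ?I" for i
    unfolding N_def using measQ Y'_meas[OF that] by (simp add: integral_distr Y'_Y[OF that])
  \<comment> \<open>Independence is a property of the joint law, which is the same for the
    coordinates under \<open>N\<close> as for the responses under \<open>M\<close>.\<close>
  have indep: "N.indep_vars (\<lambda>_. borel) Y' ?I"
  proof (subst N.indep_vars_iff_distr_eq_PiM'[OF I])
    show "Y' i \<in> borel_measurable N" if "i \<in> ?I" for i using Y'_meas[OF that] by (simp add: N_def)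
    have Y'N: "(\<lambda>y. \<lambda>i\<in>?I. Y' i y) \<in> measurable Q ?P" using Y'_meas by (intro measurable_restrict) auto
    have "distr N ?P (\<lambda>y. \<lambda>i\<in>?I. Y' i y) = distr M ?P (\<lambda>\<omega>. \<lambda>i\<in>?I. Y i \<omega>)"
      unfolding N_def distr_distr[OF Y'N measQ] by (intro distr_cong) (auto simp: Y'_Y)
    also have "\<dots> = Pi\<^sub>M ?I (\<lambda>i. distr M borel (Y i))"
    proof (rule indep_vars_iff_distr_eq_PiM'[THEN iffD1, OF I])
      show "Y i \<in> borel_measurable M" if "i \<in> ?I" for i using Yint(1)[OF that] by simp
      show "indep_vars (\<lambda>_. borel) Y ?I" using rs by (simp add: regression_setting_def)
    qed
    also have "\<dots> = Pi\<^sub>M ?I (\<lambda>i. distr N borel (Y' i))"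
    proof (intro PiM_cong refl)
      fix i assume i: "i \<in> ?I"
      show "distr M borel (Y i) = distr N borel (Y' i)"
        unfolding N_def distr_distr[OF Y'_meas[OF i] measQ] by (intro distr_cong) (auto simp: Y'_Y[OF i])
    qed
    finally show "distr N ?P (\<lambda>y. \<lambda>i\<in>?I. Y' i y) = Pi\<^sub>M ?I (\<lambda>i. distr N borel (Y' i))" .
  qed
  have rs': "regression_setting N n (h \<circ> x) Y' (fstar \<circ> r) ((\<lambda>f. f \<circ> r) ` F) c (\<lambda>y. fhat y \<circ> r)"
    unfolding regression_setting_def
  proof (intro conjI ballI)
    show "integrable N (Y' i)" if "i \<in> ?I" for i
      unfolding N_def using measQ Y'_meas[OF that] Yint[OF that] by (simp add: integrable_distr_eq Y'_Y[OF that])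
    show "(fstar \<circ> r) ((h \<circ> x) i) = integral\<^sup>L N (Y' i)" if "i \<in> ?I" for i
      using Yint(2)[OF that] mean[OF that] r[OF that] by simp
    show "(\<lambda>y. (fhat y \<circ> r) ((h \<circ> x) i)) \<in> borel_measurable ?P" if "i \<in> ?I" for i
      using rs that by (simp add: regression_setting_def r[OF that])
    fix y assume "y \<in> space N"
    then obtain \<omega> where \<omega>: "\<omega> \<in> space M" "y = ?Y \<omega>" unfolding spaceN by blast
    then have "fhat y \<in> estimator_set x n y F c" using rs by (simp add: regression_setting_def)
    then show "fhat (responses n Y' y) \<circ> r \<in> estimator_set (h \<circ> x) n (responses n Y' y) ((\<lambda>f. f \<circ> r) ` F) c"
      unfolding \<omega>(2) resp using r by (intro estimator_set_transfer)
  qed (use rs indep N.prob_space_axioms in \<open>auto simp: regression_setting_def\<close>)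
  have fbar': "fbar \<circ> r \<in> extremal_elements (h \<circ> x) n ((\<lambda>f. f \<circ> r) ` F) D"
    using h r fbar by (intro extremal_elements_transfer) auto
  have loss: "loss (h \<circ> x) n (f \<circ> r) (g \<circ> r) = loss x n f g" for f g
    using r by (auto simp: loss_def)
  have "(\<integral>\<^sup>+y. ennreal (\<bar>Y' i y - integral\<^sup>L N (Y' i)\<bar> powr p) \<partial>N)
      = (\<integral>\<^sup>+\<omega>. ennreal (\<bar>Y i \<omega> - expectation (Y i)\<bar> powr p) \<partial>M)" if "i \<in> ?I" for i p
  proof -
    have "(\<lambda>y. ennreal (\<bar>Y' i y - expectation (Y i)\<bar> powr p)) \<in> borel_measurable Q"
      using Y'_meas[OF that] by measurable
    then show ?thesis
      unfolding mean[OF that] unfolding N_def by (simp add: nn_integral_distr[OF measQ] Y'_Y[OF that])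
  qed
  then have noise: "noise_term N n Y' D = noise_term M n Y D"
    by (simp add: noise_term_def sigma_p_def)
  have "(\<integral>\<^sup>+y. ennreal (loss (h \<circ> x) n (fhat (responses n Y' y) \<circ> r) (fbar \<circ> r)) \<partial>N)
      = (\<integral>\<^sup>+\<omega>. ennreal (loss x n (fhat (?Y \<omega>)) fbar) \<partial>M)"
  proof -
    have "(\<lambda>y. loss (h \<circ> x) n (fhat (responses n Y' y) \<circ> r) (fbar \<circ> r)) \<in> borel_measurable Q"
      using measurable_loss_fhat[OF rs'] by (simp add: N_def)
    then show ?thesis unfolding N_def by (simp add: nn_integral_distr[OF measQ] resp loss)
  qed
  moreover have "(\<integral>\<^sup>+y. ennreal (loss (h \<circ> x) n (fhat (responses n Y' y) \<circ> r) (fbar \<circ> r)) \<partial>N)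
      \<le> 2 * ennreal (loss (h \<circ> x) n (fstar \<circ> r) (fbar \<circ> r)) + ennreal \<kappa> * noise_term N n Y' D
        + ennreal (c / real n)"
    using assms[unfolded first_risk_bound_def, rule_format, OF rs' D fbar'] .
  ultimately show "(\<integral>\<^sup>+\<omega>. ennreal (loss x n (fhat (?Y \<omega>)) fbar) \<partial>M)
      \<le> 2 * ennreal (loss x n fstar fbar) + ennreal \<kappa> * noise_term M n Y D + ennreal (c / real n)"
    by (simp add: loss noise)
qed

theorem theorem1:
  shows "(\<exists>\<kappa>>0. risk_bounds TYPE(nat) TYPE(nat \<Rightarrow> real) \<kappa>) \<and>
         (\<forall>\<kappa>>0. risk_bounds TYPE(nat) TYPE(nat \<Rightarrow> real) \<kappa> \<longrightarrow> risk_bounds TYPE('a) TYPE('w) \<kappa>)"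
proof (intro conjI allI impI)
  have "risk_bounds TYPE(nat) TYPE(nat \<Rightarrow> real) 124"
    by (simp add: risk_bounds_iff_first_risk_bound first_risk_bound_124)
  then show "\<exists>\<kappa>>0. risk_bounds TYPE(nat) TYPE(nat \<Rightarrow> real) \<kappa>" by (intro exI[of _ 124]) simp
  \<comment> \<open>Here \<open>\<kappa>\<close> may be smaller than 124, so the bound proved for
    124 gives nothing and the transfer is used.\<close>
  fix \<kappa> :: real assume "0 < \<kappa>" "risk_bounds TYPE(nat) TYPE(nat \<Rightarrow> real) \<kappa>"
  then show "risk_bounds TYPE('a) TYPE('w) \<kappa>"
    by (simp add: risk_bounds_iff_first_risk_bound first_risk_bound_transfer)
qed

end
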